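(* Let $M_\sigma$ be an isosceles Hopf manifold of complex dimension $n\ge 2$, let $(t,s)\in\mathbb R^2$, and let $\omega$ be (the Kähler form of) a Hermitian metric on $M_\sigma$ which is conformal to the standard Hopf metric $\omega_h$. Then $\omega$ has pointwise constant holomorphic sectional curvature with respect to its canonical connection $D^t_s$ if and only if $(1-t+ts)^2+s^2=4$ and $\omega$ is an admissible metric.
   Context: Isosceles Hopf manifolds. An isosceles Hopf manifold $M_\sigma$ is the quotient of $\mathbb C^n\setminus\{0\}$ by the infinite cyclic group generated by $\sigma(z_1,\dots,z_n)=(a_1z_1,\dots,a_nz_n)$, where $0<a=|a_1|=\cdots=|a_n|<1$. Let $\omega_0=\sqrt{-1}\sum_i dz_i\wedge d\bar z_i$, let $z$ be the column vector of coordinates, ${}^tz$ its transpose and $|z|^2=\sum_i|z_i|^2$. The form $\omega_h=\omega_0/|z|^2$ is $\sigma$-invariant and induces the standard Hopf metric on $M_\sigma$. A metric conformal to it has Kähler form $F\omega_h$ with $F$ a smooth positive function on $M_\sigma$. An admissible metric on $M_\sigma$ is a Hermitian metric whose Kähler form, pulled back to $\mathbb C^n\setminus\{0\}$, is $$\frac{c_0}{|z|^2+{}^tzAz+\overline{{}^tzAz}}\,\omega_0,$$ where $c_0>0$ is a constant and $A$ is a symmetric $n\times n$ complex matrix with $A\bar A<\frac14 I_n$ and $D_\sigma AD_\sigma=a^2A$, $D_\sigma=\mathrm{diag}\{a_1,\dots,a_n\}$. Canonical connections. Let $(M,J,g)$ be a Hermitian manifold with Levi-Civita connection $\nabla^{LC}$.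 The Chern connection $\nabla^c$ is the unique connection with $\nabla^c g=0$, $\nabla^c J=0$ and torsion having vanishing $(1,1)$ part. The Lichnerowicz connection $\nabla^l$ is the connection induced by $\nabla^{LC}$ on $T^{1,0}M$ by projection: if $\{e_i\}$ is a local frame of $T^{1,0}M$ and $\nabla^{LC}e_i=(\theta_1)_i^je_j+\overline{(\theta_2)_i^j}\,\bar e_j$, then $\nabla^l e_i=(\theta_1)_i^je_j$ (as a real connection on $TM$: $\nabla^l_XY=\frac12(\nabla^{LC}_XY-J\nabla^{LC}_X(JY))$). For $t\in\mathbb R$ the Gauduchon connection is $\nabla^t=t\nabla^c+(1-t)\nabla^l$. For $(t,s)\in\mathbb R^2$ the canonical $(t,s)$ connection is $D^t_s=(1-s)\nabla^t+s\nabla^{LC}$. Holomorphic sectional curvature. For a metric connection $\nabla$ ($\nabla g=0$), put $R^\nabla(X,Y)Z=\nabla_X\nabla_YZ-\nabla_Y\nabla_XZ-\nabla_{[X,Y]}Z$ and $R^\nabla(X,Y,Z,W)=g(R^\nabla(X,Y)Z,W)$. The holomorphic sectional curvature of the $J$-invariant plane spanned by $X,JX$ ($X\in TM\setminus\{0\}$) is $R^\nabla(X,JX,JX,X)/|X|^4$. It is pointwise constant if there is a real function $c$ on $M$ such that at every $q\in M$ all $J$-invariant planes in $T_qM$ have holomorphic sectional curvature $c(q)$. *)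

theory Defs
  imports "HOL-Analysis.Analysis"
begin

section \<open>Smooth maps on open sets\<close>

primrec Ck_on :: "nat \<Rightarrow> 'a::real_normed_vector set \<Rightarrow> ('a \<Rightarrow> 'b::real_normed_vector) \<Rightarrow> bool" where
  "Ck_on 0 U f \<longleftrightarrow> continuous_on U f"
| "Ck_on (Suc k) U f \<longleftrightarrow>
     (\<forall>x\<in>U. f differentiable (at x)) \<and> (\<forall>v. Ck_on k U (\<lambda>x. frechet_derivative f (at x) v))"

definition smooth_on :: "'a::real_normed_vector set \<Rightarrow> ('a \<Rightarrow> 'b::real_normed_vector) \<Rightarrow> bool" where
  "smooth_on U f \<longleftrightarrow> (\<forall>k. Ck_on k U f)"

section \<open>Isosceles Hopf manifolds\<close>

text \<open>
  The vector \<open>\<alpha>\<close> collects the multipliers \<open>a\<^sub>1, \<dots>, a\<^sub>n\<close>, and \<open>a\<close> is their common modulus.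
  The manifold is the set of orbits in \<open>- {0}\<close>.  As the projection from \<open>- {0}\<close> is a holomorphic
  covering, a function on the manifold is smooth iff its lift is, and vector fields and tensors on
  the manifold are the vector fields and tensors on \<open>- {0}\<close> that are invariant under \<open>hopf_map \<alpha>\<close>.
\<close>

definition isosceles :: "complex^'n \<Rightarrow> real \<Rightarrow> bool" where
  "isosceles \<alpha> a \<longleftrightarrow> 0 < a \<and> a < 1 \<and> (\<forall>i. cmod (\<alpha> $ i) = a)"

definition hopf_map :: "complex^'n \<Rightarrow> complex^'n \<Rightarrow> complex^'n" where
  "hopf_map \<alpha> z = (\<chi> i. \<alpha> $ i * z $ i)"

definition hopf_orbit :: "complex^'n \<Rightarrow> complex^'n \<Rightarrow> (complex^'n) set" where
  "hopf_orbit \<alpha> z = range (\<lambda>k::int. \<chi> i. (\<alpha> $ i) powi k * z $ i)"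

definition hopf_manifold :: "complex^'n \<Rightarrow> (complex^'n) set set" where
  "hopf_manifold \<alpha> = hopf_orbit \<alpha> ` (- {0})"

definition hopf_functions :: "complex^'n \<Rightarrow> ((complex^'n) set \<Rightarrow> real) set" where
  "hopf_functions \<alpha> = {f. smooth_on (- {0}) (\<lambda>z. f (hopf_orbit \<alpha> z))}"

text \<open>
  The value at the point \<open>0\<close>, which does not belong to the covering space, is fixed to be \<open>0\<close>,
  so that every vector field on the manifold has exactly one representative.
\<close>

definition hopf_fields :: "complex^'n \<Rightarrow> (complex^'n \<Rightarrow> complex^'n) set" where
  "hopf_fields \<alpha> = {X. smooth_on (- {0}) X \<and> X 0 = 0 \<and>
     (\<forall>z. z \<noteq> 0 \<longrightarrow> X (hopf_map \<alpha> z) = hopf_map \<alpha> (X z))}"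

definition J :: "complex^'n \<Rightarrow> complex^'n" where
  "J v = \<i> *s v"

abbreviation Jf :: "(complex^'n \<Rightarrow> complex^'n) \<Rightarrow> complex^'n \<Rightarrow> complex^'n" where
  "Jf X \<equiv> (\<lambda>z. J (X z))"

definition lie_bracket ::
  "(complex^'n \<Rightarrow> complex^'n) \<Rightarrow> (complex^'n \<Rightarrow> complex^'n) \<Rightarrow> complex^'n \<Rightarrow> complex^'n" where
  "lie_bracket X Y z = (if z = 0 then 0
     else frechet_derivative Y (at z) (X z) - frechet_derivative X (at z) (Y z))"

section \<open>Hermitian metrics\<close>

type_synonym 'n tensor2 = "complex^'n \<Rightarrow> complex^'n \<Rightarrow> complex^'n \<Rightarrow> real"

definition hermitian_metric :: "complex^'n \<Rightarrow> 'n tensor2 \<Rightarrow> bool" where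
  "hermitian_metric \<alpha> g \<longleftrightarrow>
     (\<forall>u v. smooth_on (- {0}) (\<lambda>z. g z u v)) \<and>
     (\<forall>z. z \<noteq> 0 \<longrightarrow>
        bilinear (g z) \<and>
        (\<forall>u v. g z u v = g z v u) \<and>
        (\<forall>u. u \<noteq> 0 \<longrightarrow> 0 < g z u u) \<and>
        (\<forall>u v. g z (J u) (J v) = g z u v) \<and>
        (\<forall>u v. g (hopf_map \<alpha> z) (hopf_map \<alpha> u) (hopf_map \<alpha> v) = g z u v))"

definition kahler_form :: "'n::finite tensor2 \<Rightarrow> 'n tensor2" where
  "kahler_form g z u v = g z (J u) v"

text \<open>
  \<open>\<omega>\<^sub>0 = \<i> \<Sum>\<^sub>i dz\<^sub>i \<and> d\<bar>z\<^sub>i\<close>, where \<open>(\<theta> \<and> \<eta>)(u, v) = \<theta>(u) \<eta>(v) - \<theta>(v) \<eta>(u)\<close>; on real tangent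
  vectors the argument of \<open>Re\<close> is real.
\<close>

definition omega0 :: "complex^'n \<Rightarrow> complex^'n \<Rightarrow> real" where
  "omega0 u v = Re (\<i> * (\<Sum>i\<in>UNIV. u $ i * cnj (v $ i) - v $ i * cnj (u $ i)))"

definition omega_h :: "'n::finite tensor2" where
  "omega_h z u v = omega0 u v / (norm z)\<^sup>2"

definition conformal_to_hopf :: "complex^'n \<Rightarrow> 'n tensor2 \<Rightarrow> bool" where
  "conformal_to_hopf \<alpha> g \<longleftrightarrow>
     (\<exists>F\<in>hopf_functions \<alpha>. (\<forall>q\<in>hopf_manifold \<alpha>. 0 < F q) \<and>
        (\<forall>z. z \<noteq> 0 \<longrightarrow> (\<forall>u v. kahler_form g z u v = F (hopf_orbit \<alpha> z) * omega_h z u v)))"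

definition matrix_cnj :: "complex^'n^'m \<Rightarrow> complex^'n^'m" where
  "matrix_cnj A = (\<chi> i j. cnj (A $ i $ j))"

definition diag_matrix :: "complex^'n \<Rightarrow> complex^'n^'n" where
  "diag_matrix d = (\<chi> i j. if i = j then d $ i else 0)"

definition pos_def_hermitian :: "complex^'n^'n \<Rightarrow> bool" where
  "pos_def_hermitian H \<longleftrightarrow> transpose (matrix_cnj H) = H \<and>
     (\<forall>v. v \<noteq> 0 \<longrightarrow> 0 < Re (\<Sum>i\<in>UNIV. cnj (v $ i) * (H *v v) $ i))"

definition quad_form :: "complex^'n^'n \<Rightarrow> complex^'n \<Rightarrow> complex" where
  "quad_form A z = (\<Sum>i\<in>UNIV. z $ i * (A *v z) $ i)"

definition admissible :: "complex^'n \<Rightarrow> real \<Rightarrow> 'n tensor2 \<Rightarrow> bool" where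
  "admissible \<alpha> a g \<longleftrightarrow> hermitian_metric \<alpha> g \<and>
     (\<exists>(c0::real) (A :: complex^'n^'n).
        0 < c0 \<and>
        transpose A = A \<and>
        pos_def_hermitian (mat (1/4) - A ** matrix_cnj A) \<and>
        diag_matrix \<alpha> ** A ** diag_matrix \<alpha> = a\<^sup>2 *\<^sub>R A \<and>
        (\<forall>z. z \<noteq> 0 \<longrightarrow> (\<forall>u v. kahler_form g z u v =
           c0 / Re (of_real ((norm z)\<^sup>2) + quad_form A z + cnj (quad_form A z)) * omega0 u v)))"

section \<open>Connections\<close>

type_synonym 'n connection =
  "(complex^'n \<Rightarrow> complex^'n) \<Rightarrow> (complex^'n \<Rightarrow> complex^'n) \<Rightarrow> complex^'n \<Rightarrow> complex^'n"

text \<open>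
  \<open>D X Y\<close> is the covariant derivative of \<open>Y\<close> along \<open>X\<close>.  The first condition fixes the junk values
  outside the vector fields, so that a connection is determined by its action on vector fields and
  the descriptions with \<open>THE\<close> below are meaningful.
\<close>

definition affine_connection :: "complex^'n \<Rightarrow> 'n connection \<Rightarrow> bool" where
  "affine_connection \<alpha> D \<longleftrightarrow>
     (\<forall>X Y. X \<notin> hopf_fields \<alpha> \<or> Y \<notin> hopf_fields \<alpha> \<longrightarrow> D X Y = (\<lambda>z. 0)) \<and>
     (\<forall>X\<in>hopf_fields \<alpha>. \<forall>Y\<in>hopf_fields \<alpha>. D X Y \<in> hopf_fields \<alpha>) \<and>
     (\<forall>X\<in>hopf_fields \<alpha>. \<forall>X'\<in>hopf_fields \<alpha>. \<forall>Y\<in>hopf_fields \<alpha>.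
        D (\<lambda>z. X z + X' z) Y = (\<lambda>z. D X Y z + D X' Y z)) \<and>
     (\<forall>X\<in>hopf_fields \<alpha>. \<forall>Y\<in>hopf_fields \<alpha>. \<forall>Y'\<in>hopf_fields \<alpha>.
        D X (\<lambda>z. Y z + Y' z) = (\<lambda>z. D X Y z + D X Y' z)) \<and>
     (\<forall>f\<in>hopf_functions \<alpha>. \<forall>X\<in>hopf_fields \<alpha>. \<forall>Y\<in>hopf_fields \<alpha>.
        D (\<lambda>z. f (hopf_orbit \<alpha> z) *\<^sub>R X z) Y = (\<lambda>z. f (hopf_orbit \<alpha> z) *\<^sub>R D X Y z)) \<and>
     (\<forall>f\<in>hopf_functions \<alpha>. \<forall>X\<in>hopf_fields \<alpha>. \<forall>Y\<in>hopf_fields \<alpha>. \<forall>z. z \<noteq> 0 \<longrightarrow>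
        D X (\<lambda>z. f (hopf_orbit \<alpha> z) *\<^sub>R Y z) z =
          f (hopf_orbit \<alpha> z) *\<^sub>R D X Y z +
          frechet_derivative (\<lambda>w. f (hopf_orbit \<alpha> w)) (at z) (X z) *\<^sub>R Y z)"

definition metric_connection :: "complex^'n \<Rightarrow> 'n tensor2 \<Rightarrow> 'n connection \<Rightarrow> bool" where
  "metric_connection \<alpha> g D \<longleftrightarrow>
     (\<forall>X\<in>hopf_fields \<alpha>. \<forall>Y\<in>hopf_fields \<alpha>. \<forall>Z\<in>hopf_fields \<alpha>. \<forall>z. z \<noteq> 0 \<longrightarrow>
        frechet_derivative (\<lambda>w. g w (Y w) (Z w)) (at z) (X z) =
          g z (D X Y z) (Z z) + g z (Y z) (D X Z z))"

definition complex_connection :: "complex^'n \<Rightarrow> 'n connection \<Rightarrow> bool" where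
  "complex_connection \<alpha> D \<longleftrightarrow>
     (\<forall>X\<in>hopf_fields \<alpha>. \<forall>Y\<in>hopf_fields \<alpha>. D X (Jf Y) = Jf (D X Y))"

definition torsion :: "'n::finite connection \<Rightarrow> 'n connection" where
  "torsion D X Y = (\<lambda>z. D X Y z - D Y X z - lie_bracket X Y z)"

text \<open>
  The \<open>(1,1)\<close> part of a vector-valued 2-form: the complex bilinear extension agrees with that of
  \<open>B\<close> on pairs of type \<open>(1,0),(0,1)\<close> and vanishes on pairs of equal type.
\<close>

definition part11 :: "'n::finite connection \<Rightarrow> 'n connection" where
  "part11 B X Y = (\<lambda>z. (1/2) *\<^sub>R (B X Y z + B (Jf X) (Jf Y) z))"

definition levi_civita :: "complex^'n \<Rightarrow> 'n tensor2 \<Rightarrow> 'n connection" where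
  "levi_civita \<alpha> g = (THE D. affine_connection \<alpha> D \<and> metric_connection \<alpha> g D \<and>
     (\<forall>X\<in>hopf_fields \<alpha>. \<forall>Y\<in>hopf_fields \<alpha>. torsion D X Y = (\<lambda>z. 0)))"

definition chern :: "complex^'n \<Rightarrow> 'n tensor2 \<Rightarrow> 'n connection" where
  "chern \<alpha> g = (THE D. affine_connection \<alpha> D \<and> metric_connection \<alpha> g D \<and>
     complex_connection \<alpha> D \<and>
     (\<forall>X\<in>hopf_fields \<alpha>. \<forall>Y\<in>hopf_fields \<alpha>. part11 (torsion D) X Y = (\<lambda>z. 0)))"

definition lichnerowicz :: "complex^'n \<Rightarrow> 'n tensor2 \<Rightarrow> 'n connection" where
  "lichnerowicz \<alpha> g X Y =
     (\<lambda>z. (1/2) *\<^sub>R (levi_civita \<alpha> g X Y z - J (levi_civita \<alpha> g X (Jf Y) z)))"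

definition gauduchon :: "complex^'n \<Rightarrow> 'n tensor2 \<Rightarrow> real \<Rightarrow> 'n connection" where
  "gauduchon \<alpha> g t X Y = (\<lambda>z. t *\<^sub>R chern \<alpha> g X Y z + (1 - t) *\<^sub>R lichnerowicz \<alpha> g X Y z)"

definition canonical_connection :: "complex^'n \<Rightarrow> 'n tensor2 \<Rightarrow> real \<Rightarrow> real \<Rightarrow> 'n connection" where
  "canonical_connection \<alpha> g t s X Y =
     (\<lambda>z. (1 - s) *\<^sub>R gauduchon \<alpha> g t X Y z + s *\<^sub>R levi_civita \<alpha> g X Y z)"

section \<open>Holomorphic sectional curvature\<close>

definition curvature :: "'n connection \<Rightarrow> (complex^'n \<Rightarrow> complex^'n) \<Rightarrow> 'n connection" where
  "curvature D X Y Z = (\<lambda>z. D X (D Y Z) z - D Y (D X Z) z - D (lie_bracket X Y) Z z)"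

definition hol_sect_curv ::
  "'n tensor2 \<Rightarrow> 'n connection \<Rightarrow> (complex^'n \<Rightarrow> complex^'n) \<Rightarrow> complex^'n \<Rightarrow> real" where
  "hol_sect_curv g D X z =
     g z (curvature D X (Jf X) (Jf X) z) (X z) / (g z (X z) (X z))\<^sup>2"

text \<open>
  Every nonzero tangent vector at a point of the manifold is the value there of some global vector
  field \<open>X\<close>: with \<open>\<alpha>\<^sub>i = a exp(\<i> \<theta>\<^sub>i)\<close> the invariant fields
  \<open>z \<mapsto> |z| exp(\<i> \<theta>\<^sub>i ln |z| / ln a) e\<^sub>i\<close> and their images under \<open>J\<close> form a global frame.
\<close>

definition pointwise_constant_hsc ::
  "complex^'n \<Rightarrow> 'n tensor2 \<Rightarrow> 'n connection \<Rightarrow> bool" where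
  "pointwise_constant_hsc \<alpha> g D \<longleftrightarrow>
     (\<exists>c :: (complex^'n) set \<Rightarrow> real. \<forall>q\<in>hopf_manifold \<alpha>. \<forall>z\<in>q.
        \<forall>X\<in>hopf_fields \<alpha>. X z \<noteq> 0 \<longrightarrow> hol_sect_curv g D X z = c q)"

end

theory Submission
  imports Defs "HOL-Complex_Analysis.Cauchy_Integral_Formula"
begin

text \<open>
  Write the metric as \<open>p\<^sup>-\<^sup>1\<close> times the flat one, where \<open>p > 0\<close> and \<open>p \<circ> \<sigma> = a\<^sup>2 p\<close>.  The canonical
  connection is the flat one plus a term trilinear in \<open>d ln p\<close> and the two fields, and its holomorphic
  sectional curvature is pointwise constant iff \<open>p\<^sup>\<kappa>\<^sup>/\<^sup>2\<close> (or \<open>ln p\<close> if \<open>\<kappa> = 0\<close>) has a complex Hessian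
  \<open>l I\<close>, with \<open>2 \<kappa> = (1 - t + ts)\<^sup>2 + s\<^sup>2\<close>.  As \<open>n \<ge> 2\<close>, the function \<open>l\<close> is constant.  It is positive
  because \<open>p / |z|\<^sup>2\<close> descends to the compact quotient and attains its minimum, and then comparing the
  scalings under \<open>\<sigma>\<close> forces \<open>\<kappa> = 2\<close>.  Now \<open>p - (l/4) |z|\<^sup>2\<close> is pluriharmonic; its second derivatives
  of type \<open>(2,0)\<close> are holomorphic and bounded, hence constant on every complex line missing the origin
  by Liouville's theorem, so \<open>p\<close> is a quadratic form.
\<close>

section \<open>Calculus of smooth maps\<close>

text \<open>The origin of \<kappa>: every canonical connection has parameters \<open>P\<close>,
  \<open>Q\<close>, \<open>K\<close> of sum 1 in the family of trilinear maps below, and the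
  holomorphic sectional curvature sees them only through
  \<open>\<kappa> = K\<^sup>2 + Q\<^sup>2\<close>. Since \<open>K + Q = 1 - t + ts\<close> and
  \<open>K - Q = s\<close>, the condition on \<open>(t, s)\<close> says \<kappa> = 2, the one
  exponent for which the potential is \<open>p\<close> itself. The obstacle is that the scaling
  argument says nothing if \<open>l = 0\<close>, so positivity of \<open>l\<close> has to be found
  before anything is known about \<kappa>. At the minimum of p / |z|^2 the term quadratic in
  \<open>dp\<close> vanishes in directions complex orthogonal to \<open>z\<close>, so its
  coefficient, of unknown sign, does no harm. All types are encoded by real tangent vectors: the
  complex Hessian is the real one summed over \<open>x\<close> and \<open>J x\<close>, and a
  vanishing (1,1) part is an identity in \<open>J\<close>. Under this encoding the matrix
  \<open>A\<close> is the antilinear part of the Hessian, and the bound on \<open>A\<close> restates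
  \<open>p > 0\<close>.\<close>

abbreviation fd :: "('a::real_normed_vector \<Rightarrow> 'b::real_normed_vector) \<Rightarrow> 'a \<Rightarrow> 'a \<Rightarrow> 'b" where
  "fd f z \<equiv> frechet_derivative f (at z)"

lemma fd_eqI: "(f has_derivative f') (at z) \<Longrightarrow> fd f z = f'"
  by (rule frechet_derivative_at[symmetric])

text \<open>Both maps have the same derivatives at \<open>z\<close>, and
  \<open>frechet_derivative\<close> selects by that property alone, so the equality also covers maps
  that are not differentiable there.\<close>

lemma fd_cong:
  assumes "open U" "z \<in> U" "\<And>x. x \<in> U \<Longrightarrow> f x = g x"
  shows "fd f z = fd g z"
proof -
  have "(f has_derivative f') (at z) \<longleftrightarrow> (g has_derivative f') (at z)" for f'
    using has_derivative_transform_within_open[OF _ assms(1,2), of f f' UNIV g]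
      has_derivative_transform_within_open[OF _ assms(1,2), of g f' UNIV f] assms(3) by auto
  then show ?thesis by (simp add: frechet_derivative_def)
qed

lemma Ck_on_cong:
  assumes "open U" "\<And>x. x \<in> U \<Longrightarrow> f x = g x" "Ck_on k U f"
  shows "Ck_on k U g"
  using assms(2,3)
proof (induction k arbitrary: f g)
  case 0
  then show ?case by (metis Ck_on.simps(1) continuous_on_cong)
next
  case (Suc k)
  have "g differentiable (at x)" if "x \<in> U" for x
    using Suc.prems(2) that Suc.prems(1) assms(1) has_derivative_transform_within_open
    unfolding Ck_on.simps differentiable_def by meson
  moreover have "Ck_on k U (\<lambda>x. fd g x v)" for v
  proof (rule Suc.IH)
    show "Ck_on k U (\<lambda>x. fd f x v)" using Suc.prems(2) by simp
    show "fd f x v = fd g x v" if "x \<in> U" for x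
      using fd_cong[OF assms(1) that Suc.prems(1)] by simp
  qed
  ultimately show ?case by simp
qed

lemma smooth_on_cong:
  "open U \<Longrightarrow> (\<And>x. x \<in> U \<Longrightarrow> f x = g x) \<Longrightarrow> smooth_on U f \<Longrightarrow> smooth_on U g"
  unfolding smooth_on_def using Ck_on_cong by blast

lemma Ck_on_SucI:
  assumes "open U" "\<And>x. x \<in> U \<Longrightarrow> (f has_derivative f' x) (at x)"
    and "\<And>v. Ck_on k U (\<lambda>x. f' x v)"
  shows "Ck_on (Suc k) U f"
proof -
  have "Ck_on k U (\<lambda>x. fd f x v)" for v
    by (rule Ck_on_cong[OF assms(1) _ assms(3)[of v]]) (simp add: fd_eqI[OF assms(2)])
  then show ?thesis using assms(2) by (auto simp: differentiable_def)
qed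

lemma Ck_on_Suc_has_derivative:
  "Ck_on (Suc k) U f \<Longrightarrow> x \<in> U \<Longrightarrow> (f has_derivative fd f x) (at x)"
  by (auto simp flip: frechet_derivative_works)

lemma Ck_on_Suc_fd: "Ck_on (Suc k) U f \<Longrightarrow> Ck_on k U (\<lambda>x. fd f x v)"
  by simp

lemma Ck_on_Suc_imp: "Ck_on (Suc k) U f \<Longrightarrow> Ck_on k U f"
proof (induction k arbitrary: f)
  case 0
  then show ?case
    by (auto intro!: continuous_at_imp_continuous_on differentiable_imp_continuous_within)
next
  case (Suc k)
  then show ?case by (metis Ck_on.simps(2))
qed

lemma smooth_on_continuous: "smooth_on U f \<Longrightarrow> continuous_on U f"
  unfolding smooth_on_def by (metis Ck_on.simps(1))

lemma smooth_on_has_derivative: "smooth_on U f \<Longrightarrow> x \<in> U \<Longrightarrow> (f has_derivative fd f x) (at x)"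
  unfolding smooth_on_def using Ck_on_Suc_has_derivative by blast

lemma smooth_on_linear_fd: "smooth_on U f \<Longrightarrow> x \<in> U \<Longrightarrow> bounded_linear (fd f x)"
  by (meson has_derivative_bounded_linear smooth_on_has_derivative)

lemma smooth_on_fd: "smooth_on U f \<Longrightarrow> smooth_on U (\<lambda>x. fd f x v)"
  unfolding smooth_on_def using Ck_on_Suc_fd by blast

lemma Ck_on_const: "Ck_on k U (\<lambda>x. c)"
  by (induction k arbitrary: c) simp_all

lemma smooth_on_const: "smooth_on U (\<lambda>x. c)"
  by (simp add: smooth_on_def Ck_on_const)

lemma Ck_on_add:
  assumes "open U" "Ck_on k U f" "Ck_on k U g"
  shows "Ck_on k U (\<lambda>x. f x + g x)"
  using assms(2,3)
proof (induction k arbitrary: f g)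
  case 0
  then show ?case by (simp add: continuous_on_add)
next
  case (Suc k)
  show ?case
    by (rule Ck_on_SucI[OF assms(1) has_derivative_add[OF Ck_on_Suc_has_derivative[OF Suc.prems(1)]
          Ck_on_Suc_has_derivative[OF Suc.prems(2)]]])
      (assumption | intro Suc.IH Ck_on_Suc_fd[OF Suc.prems(1)] Ck_on_Suc_fd[OF Suc.prems(2)])+
qed

lemma smooth_on_add:
  "open U \<Longrightarrow> smooth_on U f \<Longrightarrow> smooth_on U g \<Longrightarrow> smooth_on U (\<lambda>x. f x + g x)"
  unfolding smooth_on_def using Ck_on_add by blast

lemma Ck_on_linear_compose:
  assumes "open U" "bounded_linear L" "Ck_on k U f"
  shows "Ck_on k U (\<lambda>x. L (f x))"
  using assms(3)
proof (induction k arbitrary: f)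
  case 0
  then show ?case by (simp add: assms(2) bounded_linear.continuous_on)
next
  case (Suc k)
  show ?case
    by (rule Ck_on_SucI[OF assms(1) bounded_linear.has_derivative[OF assms(2)
          Ck_on_Suc_has_derivative[OF Suc.prems(1)]]])
      (assumption | intro Suc.IH Ck_on_Suc_fd[OF Suc.prems(1)])+
qed

lemma smooth_on_linear_compose:
  "open U \<Longrightarrow> bounded_linear L \<Longrightarrow> smooth_on U f \<Longrightarrow> smooth_on U (\<lambda>x. L (f x))"
  unfolding smooth_on_def using Ck_on_linear_compose by blast

lemma Ck_on_id: "Ck_on k U (\<lambda>x. x)"
  by (cases k) (simp_all add: Ck_on_const)

lemma smooth_on_id: "smooth_on U (\<lambda>x. x)"
  by (simp add: smooth_on_def Ck_on_id)

lemma Ck_on_bilinear: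
  assumes "open U" "bounded_bilinear B" "Ck_on k U f" "Ck_on k U g"
  shows "Ck_on k U (\<lambda>x. B (f x) (g x))"
  using assms(3,4)
proof (induction k arbitrary: f g)
  case 0
  then show ?case by (simp add: assms(2) bounded_bilinear.continuous_on)
next
  case (Suc k)
  show ?case
    by (rule Ck_on_SucI[OF assms(1) bounded_bilinear.FDERIV[OF assms(2)
          Ck_on_Suc_has_derivative[OF Suc.prems(1)] Ck_on_Suc_has_derivative[OF Suc.prems(2)]]])
      (assumption | intro Ck_on_add[OF assms(1)] Suc.IH Ck_on_Suc_fd[OF Suc.prems(1)] Ck_on_Suc_fd[OF Suc.prems(2)]
        Ck_on_Suc_imp[OF Suc.prems(1)] Ck_on_Suc_imp[OF Suc.prems(2)])+
qed

lemma smooth_on_bilinear: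
  "open U \<Longrightarrow> bounded_bilinear B \<Longrightarrow> smooth_on U f \<Longrightarrow> smooth_on U g \<Longrightarrow>
    smooth_on U (\<lambda>x. B (f x) (g x))"
  unfolding smooth_on_def using Ck_on_bilinear by blast

lemmas smooth_on_scaleR = smooth_on_bilinear[OF _ bounded_bilinear_scaleR]
lemmas smooth_on_mult = smooth_on_bilinear[OF _ bounded_bilinear_mult]
lemmas smooth_on_inner = smooth_on_bilinear[OF _ bounded_bilinear_inner]

lemma smooth_on_diff:
  assumes "open U" "smooth_on U f" "smooth_on U g"
  shows "smooth_on U (\<lambda>x. f x - g x)"
  using smooth_on_add[OF assms(1,2) smooth_on_linear_compose[OF assms(1) _ assms(3), of uminus]]
  by (simp add: bounded_linear_minus bounded_linear_ident)

lemma smooth_on_sum: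
  assumes "open U" "\<And>i. i \<in> I \<Longrightarrow> smooth_on U (f i)"
  shows "smooth_on U (\<lambda>x. \<Sum>i\<in>I. f i x)"
  using assms(2)
  by (induction I rule: infinite_finite_induct) (auto intro!: smooth_on_const smooth_on_add[OF assms(1)])

section \<open>Real and complex powers of positive functions\<close>

text \<open>The powers of \<open>r\<close> form a family closed under differentiation: the factor 1
  / r is absorbed by lowering the exponent by 1. Hence the induction over all exponents at once.
  Complex exponents are needed for the invariant vector fields.\<close>

lemma smooth_on_exp_ln:
  fixes r :: "'a::real_normed_vector \<Rightarrow> real" and \<beta> :: "'b::{real_normed_field,banach}"
  assumes "open U" "smooth_on U r" "\<And>x. x \<in> U \<Longrightarrow> 0 < r x"
  shows "smooth_on U (\<lambda>x. exp (\<beta> * of_real (ln (r x))))"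
  unfolding smooth_on_def
proof
  show "Ck_on k U (\<lambda>x. exp (\<beta> * of_real (ln (r x))))" for k
  proof (induction k arbitrary: \<beta>)
    case 0
    have "continuous_on U r" using assms(2) by (rule smooth_on_continuous)
    then show ?case
      using assms(3) by (force intro!: continuous_intros)
  next
    case (Suc k)
    have der: "((\<lambda>x. exp (\<beta> * of_real (ln (r x)))) has_derivative
        (\<lambda>v. of_real (fd r x v) * (\<beta> * exp ((\<beta> - 1) * of_real (ln (r x)))))) (at x)"
      if x: "x \<in> U" for x
    proof -
      have r: "0 < r x" and dr: "(r has_derivative fd r x) (at x)"
        using assms(3)[OF x] smooth_on_has_derivative[OF assms(2) x] by auto
      have e: "exp ((\<beta> - 1) * of_real (ln (r x))) = exp (\<beta> * of_real (ln (r x))) / of_real (r x)"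
        using r exp_of_real[of "ln (r x)", where 'a='b] by (simp add: left_diff_distrib exp_diff)
      have dl: "((\<lambda>x. of_real (ln (r x)) :: 'b) has_derivative (\<lambda>v. of_real (fd r x v * inverse (r x)))) (at x)"
        using has_derivative_of_real[OF has_derivative_ln[OF r dr]] .
      have dm: "((\<lambda>x. \<beta> * of_real (ln (r x))) has_derivative (\<lambda>v. \<beta> * of_real (fd r x v * inverse (r x)))) (at x)"
        by (rule has_derivative_mult_right[OF dl])
      have "(exp has_derivative (\<lambda>h. exp (\<beta> * of_real (ln (r x))) * h)) (at (\<beta> * of_real (ln (r x))))"
        using DERIV_exp unfolding has_field_derivative_def .
      from diff_chain_at[OF dm this] show ?thesis
        unfolding e by (simp add: o_def field_simps)
    qed
    show ?case
    proof (rule Ck_on_SucI[OF assms(1) der])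
      fix v
      have "Ck_on k U (\<lambda>x. fd r x v)" using smooth_on_fd[OF assms(2)] by (simp add: smooth_on_def)
      then show "Ck_on k U (\<lambda>x. of_real (fd r x v) * (\<beta> * exp ((\<beta> - 1) * of_real (ln (r x)))))"
        by (intro Ck_on_bilinear[OF assms(1) bounded_bilinear_mult] Ck_on_const Suc.IH
            Ck_on_linear_compose[OF assms(1) bounded_linear_of_real])
    qed
  qed
qed

lemma smooth_on_powr:
  fixes r :: "'a::real_normed_vector \<Rightarrow> real"
  assumes "open U" "smooth_on U r" "\<And>x. x \<in> U \<Longrightarrow> 0 < r x"
  shows "smooth_on U (\<lambda>x. r x powr b)"
  by (rule smooth_on_cong[OF assms(1) _ smooth_on_exp_ln[OF assms, of b]])
    (use assms(3) in \<open>force simp: powr_def\<close>)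

lemma smooth_on_inverse:
  fixes r :: "'a::real_normed_vector \<Rightarrow> real"
  assumes "open U" "smooth_on U r" "\<And>x. x \<in> U \<Longrightarrow> 0 < r x"
  shows "smooth_on U (\<lambda>x. inverse (r x))"
  by (rule smooth_on_cong[OF assms(1) _ smooth_on_powr[OF assms, of "-1"]])
    (use assms(3) in \<open>simp add: powr_minus powr_one less_imp_le\<close>)

lemma linear_eq_sum_Basis:
  fixes L :: "'a::euclidean_space \<Rightarrow> 'b::real_normed_vector"
  assumes "bounded_linear L"
  shows "L v = (\<Sum>b\<in>Basis. (v \<bullet> b) *\<^sub>R L b)"
proof -
  interpret bounded_linear L by fact
  have "L v = L (\<Sum>b\<in>Basis. (v \<bullet> b) *\<^sub>R b)" by (simp add: euclidean_representation)
  then show ?thesis by (simp add: sum scaleR)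
qed

text \<open>\<open>smooth_on\<close> controls derivatives in fixed directions only; a variable
  direction is reduced to these by expanding it in the basis.\<close>

lemma smooth_on_fd_apply:
  fixes Y :: "'a::euclidean_space \<Rightarrow> 'b::real_normed_vector"
  assumes "open U" "smooth_on U Y" "smooth_on U X"
  shows "smooth_on U (\<lambda>z. fd Y z (X z))"
proof (rule smooth_on_cong[OF assms(1)])
  show "smooth_on U (\<lambda>z. \<Sum>b\<in>Basis. (X z \<bullet> b) *\<^sub>R fd Y z b)"
    by (intro smooth_on_sum smooth_on_scaleR smooth_on_inner smooth_on_const smooth_on_fd assms)
  show "(\<Sum>b\<in>Basis. (X z \<bullet> b) *\<^sub>R fd Y z b) = fd Y z (X z)" if "z \<in> U" for z
    using linear_eq_sum_Basis[OF smooth_on_linear_fd[OF assms(2) that]] by metis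
qed

lemma has_derivative_fd_apply:
  fixes Y :: "'a::euclidean_space \<Rightarrow> 'b::real_normed_vector"
  assumes U: "open U" "smooth_on U Y" "z \<in> U" and X: "(X has_derivative X') (at z)"
  shows "((\<lambda>z. fd Y z (X z)) has_derivative
          (\<lambda>v. fd (\<lambda>w. fd Y w (X z)) z v + fd Y z (X' v))) (at z)"
proof (rule has_derivative_transform_within_open[OF _ U(1,3)])
  note lin = linear_eq_sum_Basis[OF smooth_on_linear_fd[OF U(2)]]
  have der: "((\<lambda>w. fd Y w b) has_derivative fd (\<lambda>w. fd Y w b) z) (at z)" for b
    by (rule smooth_on_has_derivative[OF smooth_on_fd[OF U(2)] U(3)])
  have "((\<lambda>w. \<Sum>b\<in>Basis. (X z \<bullet> b) *\<^sub>R fd Y w b) has_derivative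
      (\<lambda>v. \<Sum>b\<in>Basis. (X z \<bullet> b) *\<^sub>R fd (\<lambda>w. fd Y w b) z v)) (at z)"
    by (intro has_derivative_sum has_derivative_scaleR_right der)
  then have "((\<lambda>w. fd Y w (X z)) has_derivative
      (\<lambda>v. \<Sum>b\<in>Basis. (X z \<bullet> b) *\<^sub>R fd (\<lambda>w. fd Y w b) z v)) (at z)"
    by (rule has_derivative_transform_within_open[OF _ U(1,3)]) (metis lin)
  then have e: "fd (\<lambda>w. fd Y w (X z)) z = (\<lambda>v. \<Sum>b\<in>Basis. (X z \<bullet> b) *\<^sub>R fd (\<lambda>w. fd Y w b) z v)"
    by (rule fd_eqI)
  have "((\<lambda>w. \<Sum>b\<in>Basis. (X w \<bullet> b) *\<^sub>R fd Y w b) has_derivative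
      (\<lambda>v. \<Sum>b\<in>Basis. (X z \<bullet> b) *\<^sub>R fd (\<lambda>w. fd Y w b) z v + (X' v \<bullet> b) *\<^sub>R fd Y z b)) (at z)"
    by (intro has_derivative_sum has_derivative_scaleR der has_derivative_inner_left X)
  then show "((\<lambda>w. \<Sum>b\<in>Basis. (X w \<bullet> b) *\<^sub>R fd Y w b) has_derivative
      (\<lambda>v. fd (\<lambda>w. fd Y w (X z)) z v + fd Y z (X' v))) (at z)"
    unfolding e sum.distrib lin[OF U(3), of "X' _"] .
  show "(\<Sum>b\<in>Basis. (X w \<bullet> b) *\<^sub>R fd Y w b) = fd Y w (X w)" if "w \<in> U" for w
    using lin[OF that] by metis
qed

section \<open>Symmetry of second derivatives\<close>

text \<open>The mean value theorem is applied along \<open>u\<close> to the difference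
  \<open>q\<close> in direction \<open>v\<close>, then along \<open>v\<close> to the derivative. The
  left side is symmetric in \<open>u\<close> and \<open>v\<close>, the right side is not, and this
  is what yields the symmetry.\<close>

lemma mixed_difference_mean_value:
  fixes f :: "'a::real_normed_vector \<Rightarrow> real"
  assumes U: "smooth_on U f" and h: "0 < h"
    and sub: "\<And>s t. 0 \<le> s \<Longrightarrow> s \<le> h \<Longrightarrow> 0 \<le> t \<Longrightarrow> t \<le> h \<Longrightarrow> z + s *\<^sub>R u + t *\<^sub>R v \<in> U"
  obtains s t where "0 < s" "s < h" "0 < t" "t < h"
    "f (z + h *\<^sub>R u + h *\<^sub>R v) - f (z + h *\<^sub>R u) - f (z + h *\<^sub>R v) + f z
      = h * (h * fd (\<lambda>w. fd f w u) (z + s *\<^sub>R u + t *\<^sub>R v) v)"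
proof -
  have line: "((\<lambda>s. F (c + s *\<^sub>R e)) has_real_derivative fd F (c + s *\<^sub>R e) e) (at s)"
    if "smooth_on U F" "c + s *\<^sub>R e \<in> U" for F :: "'a \<Rightarrow> real" and c e s
  proof -
    have "((\<lambda>s. c + s *\<^sub>R e) has_derivative (\<lambda>x. x *\<^sub>R e)) (at s)"
      by (auto intro!: derivative_eq_intros)
    from diff_chain_at[OF this smooth_on_has_derivative[OF that]]
    have "((\<lambda>s. F (c + s *\<^sub>R e)) has_derivative (\<lambda>x. fd F (c + s *\<^sub>R e) (x *\<^sub>R e))) (at s)"
      by (simp add: o_def)
    moreover have "(\<lambda>x. fd F (c + s *\<^sub>R e) (x *\<^sub>R e)) = (*) (fd F (c + s *\<^sub>R e) e)"
      using linear_scale[OF bounded_linear.linear[OF smooth_on_linear_fd[OF that]]] by (auto simp: mult.commute)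
    ultimately show ?thesis by (simp add: has_field_derivative_def)
  qed
  define q where "q s = f (z + s *\<^sub>R u + h *\<^sub>R v) - f (z + s *\<^sub>R u)" for s
  have "\<exists>s. 0 < s \<and> s < h \<and> q h - q 0 = (h - 0) * (fd f (z + s *\<^sub>R u + h *\<^sub>R v) u - fd f (z + s *\<^sub>R u) u)"
  proof (rule MVT2[OF h])
    fix s assume s: "0 \<le> s" "s \<le> h"
    have "((\<lambda>s. f ((z + h *\<^sub>R v) + s *\<^sub>R u)) has_real_derivative fd f ((z + h *\<^sub>R v) + s *\<^sub>R u) u) (at s)"
      using sub[OF s, of h] h by (intro line[OF U]) (simp add: add_ac)
    moreover have "((\<lambda>s. f (z + s *\<^sub>R u)) has_real_derivative fd f (z + s *\<^sub>R u) u) (at s)"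
      using sub[OF s, of 0] h by (intro line[OF U]) simp
    ultimately show "(q has_real_derivative fd f (z + s *\<^sub>R u + h *\<^sub>R v) u - fd f (z + s *\<^sub>R u) u) (at s)"
      unfolding q_def[abs_def] by (auto intro!: derivative_eq_intros simp: add_ac)
  qed
  then obtain s where s: "0 < s" "s < h"
    "q h - q 0 = h * (fd f (z + s *\<^sub>R u + h *\<^sub>R v) u - fd f (z + s *\<^sub>R u) u)" by auto
  have "\<exists>t. 0 < t \<and> t < h \<and> fd f (z + s *\<^sub>R u + h *\<^sub>R v) u - fd f (z + s *\<^sub>R u + 0 *\<^sub>R v) u =
      (h - 0) * fd (\<lambda>w. fd f w u) (z + s *\<^sub>R u + t *\<^sub>R v) v"
    by (rule MVT2[OF h]) (use sub s in \<open>auto intro!: line[OF smooth_on_fd[OF U]]\<close>)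
  then obtain t where t: "0 < t" "t < h"
    "fd f (z + s *\<^sub>R u + h *\<^sub>R v) u - fd f (z + s *\<^sub>R u) u = h * fd (\<lambda>w. fd f w u) (z + s *\<^sub>R u + t *\<^sub>R v) v"
    by auto
  show thesis
    by (rule that[OF s(1,2) t(1,2)]) (use s(3) t(3) in \<open>simp add: q_def\<close>)
qed

text \<open>One second difference is a value of either mixed derivative at points near
  \<open>z\<close>. By continuity each value is within \<open>e\<close> of the one at
  \<open>z\<close>, while the two at \<open>z\<close> are \<open>2 * e\<close> apart.\<close>

lemma second_derivative_symmetric_real:
  fixes f :: "'a::real_normed_vector \<Rightarrow> real"
  assumes U: "open U" "smooth_on U f" "z \<in> U"
  shows "fd (\<lambda>w. fd f w u) z v = fd (\<lambda>w. fd f w v) z u"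
proof (rule ccontr)
  define A where "A u v w = fd (\<lambda>w. fd f w u) w v" for u v w
  assume "fd (\<lambda>w. fd f w u) z v \<noteq> fd (\<lambda>w. fd f w v) z u"
  then have ne: "A u v z \<noteq> A v u z" by (simp add: A_def)
  define e where "e = \<bar>A u v z - A v u z\<bar> / 2"
  have e: "0 < e" using ne by (simp add: e_def)
  have cont: "continuous (at z) (A u v)" for u v
    unfolding A_def[abs_def]
    using smooth_on_continuous[OF smooth_on_fd[OF smooth_on_fd[OF U(2)]]] U(1,3)
    by (simp add: continuous_on_eq_continuous_at)
  obtain d1 where d1: "0 < d1" "\<And>w. dist w z < d1 \<Longrightarrow> \<bar>A u v w - A u v z\<bar> < e"
    using cont[of u v] e unfolding continuous_at_eps_delta dist_real_def by (metis dist_commute)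
  obtain d2 where d2: "0 < d2" "\<And>w. dist w z < d2 \<Longrightarrow> \<bar>A v u w - A v u z\<bar> < e"
    using cont[of v u] e unfolding continuous_at_eps_delta dist_real_def by (metis dist_commute)
  obtain d3 where d3: "0 < d3" "ball z d3 \<subseteq> U" using U(1,3) open_contains_ball by blast
  define d where "d = min d1 (min d2 d3)"
  have d: "0 < d" using d1 d2 d3 by (simp add: d_def)
  \<comment> \<open>This size keeps the whole parallelogram within distance d / 2 of
    \<open>z\<close>; the summand 1 covers \<open>u = v = 0\<close>.\<close>
  define h where "h = d / (2 * (norm u + norm v + 1))"
  have pos: "0 < norm u + norm v + 1" by (smt (verit) norm_ge_zero)
  have h: "0 < h" using d pos by (simp add: h_def)
  have near: "dist (z + s *\<^sub>R u + t *\<^sub>R v) z < d" if "0 \<le> s" "s \<le> h" "0 \<le> t" "t \<le> h" for s t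
  proof -
    have "dist (z + s *\<^sub>R u + t *\<^sub>R v) z = norm (s *\<^sub>R u + t *\<^sub>R v)" by (simp add: dist_norm algebra_simps)
    also have "\<dots> \<le> norm (s *\<^sub>R u) + norm (t *\<^sub>R v)" by (rule norm_triangle_ineq)
    also have "\<dots> \<le> h * norm u + h * norm v" using that by (intro add_mono) (auto intro: mult_right_mono)
    also have "\<dots> \<le> h * (norm u + norm v + 1)" using h by (simp add: algebra_simps)
    also have "\<dots> = d / 2" using pos unfolding h_def by (simp add: field_simps)
    also have "\<dots> < d" using d by simp
    finally show ?thesis .
  qed
  then have sub: "z + s *\<^sub>R u + t *\<^sub>R v \<in> U" if "0 \<le> s" "s \<le> h" "0 \<le> t" "t \<le> h" for s t
    using that d3(2) by (force simp: d_def dist_commute)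
  obtain s t where st: "0 < s" "s < h" "0 < t" "t < h"
    "f (z + h *\<^sub>R u + h *\<^sub>R v) - f (z + h *\<^sub>R u) - f (z + h *\<^sub>R v) + f z = h * (h * A u v (z + s *\<^sub>R u + t *\<^sub>R v))"
    using mixed_difference_mean_value[OF U(2) h sub] unfolding A_def by blast
  have sub': "z + s *\<^sub>R v + t *\<^sub>R u \<in> U" if "0 \<le> s" "s \<le> h" "0 \<le> t" "t \<le> h" for s t
    using sub[OF that(3,4,1,2)] by (simp add: add_ac)
  obtain s' t' where st': "0 < s'" "s' < h" "0 < t'" "t' < h"
    "f (z + h *\<^sub>R v + h *\<^sub>R u) - f (z + h *\<^sub>R v) - f (z + h *\<^sub>R u) + f z = h * (h * A v u (z + s' *\<^sub>R v + t' *\<^sub>R u))"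
    using mixed_difference_mean_value[OF U(2) h sub'] unfolding A_def by blast
  have "f (z + h *\<^sub>R v + h *\<^sub>R u) = f (z + h *\<^sub>R u + h *\<^sub>R v)" by (simp add: add_ac)
  with st(5) st'(5) have "h * (h * A u v (z + s *\<^sub>R u + t *\<^sub>R v)) = h * (h * A v u (z + s' *\<^sub>R v + t' *\<^sub>R u))"
    by linarith
  then have eq: "A u v (z + s *\<^sub>R u + t *\<^sub>R v) = A v u (z + t' *\<^sub>R u + s' *\<^sub>R v)" using h by (auto simp: add_ac)
  have "\<bar>A u v (z + s *\<^sub>R u + t *\<^sub>R v) - A u v z\<bar> < e"
    using near[of s t] st by (intro d1(2)) (auto simp: d_def)
  moreover have "\<bar>A v u (z + t' *\<^sub>R u + s' *\<^sub>R v) - A v u z\<bar> < e"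
    using near[of t' s'] st' by (intro d2(2)) (auto simp: d_def)
  ultimately show False using eq unfolding e_def by (simp only: eq) (auto simp: abs_if split: if_splits)
qed

lemma fd_linear_compose:
  assumes "bounded_linear L" "smooth_on U f" "z \<in> U"
  shows "fd (\<lambda>w. L (f w)) z = (\<lambda>v. L (fd f z v))"
  by (rule fd_eqI[OF bounded_linear.has_derivative[OF assms(1) smooth_on_has_derivative[OF assms(2,3)]]])

lemma second_derivative_symmetric:
  fixes f :: "'a::real_normed_vector \<Rightarrow> 'b::euclidean_space"
  assumes U: "open U" "smooth_on U f" "z \<in> U"
  shows "fd (\<lambda>w. fd f w u) z v = fd (\<lambda>w. fd f w v) z u"
proof (rule euclidean_eqI)
  fix b :: 'b assume "b \<in> Basis"
  note L = bounded_linear_inner_left[of b]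
  have *: "fd (\<lambda>w. fd (\<lambda>w. f w \<bullet> b) w u) z v = fd (\<lambda>w. fd f w u) z v \<bullet> b" for u v
  proof -
    have "fd (\<lambda>w. fd (\<lambda>w. f w \<bullet> b) w u) z = fd (\<lambda>w. fd f w u \<bullet> b) z"
      by (rule fd_cong[OF U(1,3)]) (simp add: fd_linear_compose[OF L U(2)])
    also have "\<dots> = (\<lambda>v. fd (\<lambda>w. fd f w u) z v \<bullet> b)"
      by (rule fd_linear_compose[OF L smooth_on_fd[OF U(2)] U(3)])
    finally show ?thesis by simp
  qed
  show "fd (\<lambda>w. fd f w u) z v \<bullet> b = fd (\<lambda>w. fd f w v) z u \<bullet> b"
    using second_derivative_symmetric_real[OF U(1) smooth_on_linear_compose[OF U(1) L U(2)] U(3)] *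
    by metis
qed

section \<open>The complex structure and the deck transformation\<close>

lemma linear_J: "linear J"
  by (rule linearI) (simp_all add: J_def vec_eq_iff algebra_simps)

lemma bounded_linear_J: "bounded_linear (J :: complex^'n \<Rightarrow> _)"
  using linear_J by (rule linear_conv_bounded_linear[THEN iffD1])

lemma smooth_on_J: "open U \<Longrightarrow> smooth_on U f \<Longrightarrow> smooth_on U (\<lambda>x. J (f x))"
  by (rule smooth_on_linear_compose[OF _ bounded_linear_J])

lemmas J_simps = linear_add[OF linear_J] linear_diff[OF linear_J] linear_scale[OF linear_J]
  linear_0[OF linear_J] linear_neg[OF linear_J]

lemma J_J [simp]: "J (J v) = - v"
  by (simp add: J_def vec_eq_iff)

lemma inner_J_J [simp]: "J u \<bullet> J v = u \<bullet> v"
  by (simp add: J_def inner_vec_def inner_complex_def algebra_simps)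

lemma inner_J_left: "J u \<bullet> v = - (u \<bullet> J v)"
  using inner_J_J[of u "J v"] by (simp add: inner_minus_right)

lemma inner_J_self [simp]: "u \<bullet> J u = 0" "J u \<bullet> u = 0"
  using inner_J_left[of u u] by (simp_all add: inner_commute)

lemma J_eq_0_iff [simp]: "J v = 0 \<longleftrightarrow> v = 0"
  by (metis J_J J_simps(4) neg_equal_0_iff_equal)

lemma linear_hopf_map: "linear (hopf_map \<alpha>)"
  by (rule linearI) (simp_all add: hopf_map_def vec_eq_iff algebra_simps)

lemma bounded_linear_hopf_map: "bounded_linear (hopf_map \<alpha>)"
  using linear_hopf_map by (rule linear_conv_bounded_linear[THEN iffD1])

lemmas hopf_map_simps = linear_add[OF linear_hopf_map] linear_diff[OF linear_hopf_map]
  linear_scale[OF linear_hopf_map] linear_0[OF linear_hopf_map] linear_neg[OF linear_hopf_map]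

lemma J_hopf_map: "J (hopf_map \<alpha> v) = hopf_map \<alpha> (J v)"
  by (simp add: J_def hopf_map_def vec_eq_iff)

locale isosceles_hopf =
  fixes \<alpha> :: "complex^'n" and a :: real
  assumes isosceles: "isosceles \<alpha> a"
begin

lemma a_pos: "0 < a" and a_less_1: "a < 1" and cmod_multiplier: "cmod (\<alpha> $ i) = a"
  using isosceles by (auto simp: isosceles_def)

lemma multiplier_nonzero [simp]: "\<alpha> $ i \<noteq> 0"
  using cmod_multiplier[of i] a_pos by auto

lemma inner_hopf_map: "hopf_map \<alpha> u \<bullet> hopf_map \<alpha> v = a\<^sup>2 * (u \<bullet> v)"
proof -
  have "(\<alpha> $ i * u $ i) \<bullet> (\<alpha> $ i * v $ i) = a\<^sup>2 * (u $ i \<bullet> v $ i)" for i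
  proof -
    have "(\<alpha> $ i * u $ i) \<bullet> (\<alpha> $ i * v $ i) = (cmod (\<alpha> $ i))\<^sup>2 * (u $ i \<bullet> v $ i)"
      unfolding cmod_power2 by (simp add: inner_complex_def algebra_simps power2_eq_square)
    then show ?thesis by (simp add: cmod_multiplier)
  qed
  then show ?thesis by (simp add: hopf_map_def inner_vec_def sum_distrib_left)
qed

lemma norm_hopf_map: "norm (hopf_map \<alpha> u) = a * norm u"
  using inner_hopf_map[of u u] a_pos by (simp add: norm_eq_sqrt_inner real_sqrt_mult)

lemma hopf_map_eq_0_iff [simp]: "hopf_map \<alpha> u = 0 \<longleftrightarrow> u = 0"
  using norm_hopf_map[of u] a_pos by (metis mult_eq_0_iff norm_eq_zero less_irrefl)

lemma hopf_map_surj: obtains u where "hopf_map \<alpha> u = v"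
proof
  show "hopf_map \<alpha> (\<chi> i. v $ i / \<alpha> $ i) = v" by (simp add: hopf_map_def vec_eq_iff)
qed

lemma hopf_orbit_hopf_map: "hopf_orbit \<alpha> (hopf_map \<alpha> z) = hopf_orbit \<alpha> z"
proof -
  let ?s = "\<lambda>k::int. \<chi> i. (\<alpha> $ i) powi k * z $ i"
  have "hopf_orbit \<alpha> (hopf_map \<alpha> z) = range (\<lambda>k. ?s (k + 1))"
    by (simp add: hopf_orbit_def hopf_map_def power_int_add mult.assoc)
  also have "\<dots> = range ?s"
  proof -
    have "?s k \<in> range (\<lambda>k. ?s (k + 1))" for k by (rule range_eqI[of _ _ "k - 1"]) simp
    then show ?thesis by blast
  qed
  finally show ?thesis by (simp add: hopf_orbit_def)
qed

text \<open>The annulus \<open>a \<le> |z| \<le> 1\<close> meets every orbit.\<close>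

lemma hopf_invariant_induct:
  assumes annulus: "\<And>z. a \<le> norm z \<Longrightarrow> norm z \<le> 1 \<Longrightarrow> R z"
    and invariant: "\<And>z. z \<noteq> 0 \<Longrightarrow> R (hopf_map \<alpha> z) \<longleftrightarrow> R z"
    and "z \<noteq> 0"
  shows "R z"
proof -
  \<comment> \<open>Points of the unit ball below the annulus are pulled outward by the inverse of
    the deck map, one factor \<open>a\<close> per induction step. Points outside the ball are later
    pushed inward until this case applies.\<close>
  have small: "a ^ Suc n \<le> norm z \<Longrightarrow> norm z \<le> 1 \<Longrightarrow> R z" for n z
  proof (induction n arbitrary: z)
    case 0
    then show ?case using annulus by simp
  next
    case (Suc n)
    show ?case
    proof (cases "a \<le> norm z")
      case True
      then show ?thesis using annulus Suc.prems by simp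
    next
      case False
      obtain w where w: "hopf_map \<alpha> w = z" by (rule hopf_map_surj)
      have nw: "norm z = a * norm w" using norm_hopf_map w by auto
      have z: "z \<noteq> 0" using Suc.prems(1) a_pos by (metis norm_zero not_le zero_less_power)
      have "a * a ^ Suc n \<le> a * norm w" using Suc.prems(1) nw by simp
      then have "a ^ Suc n \<le> norm w" using a_pos mult_le_cancel_left_pos by blast
      moreover have "norm w \<le> 1" using False nw a_pos by (simp add: not_le)
      ultimately have "R w" by (rule Suc.IH)
      then show ?thesis using invariant[of w] w z by auto
    qed
  qed
  have bounded: "z \<noteq> 0 \<Longrightarrow> a ^ n * norm z \<le> 1 \<Longrightarrow> R z" for n z
  proof (induction n arbitrary: z)
    case 0
    obtain n where "a ^ n < norm z"
      using real_arch_pow_inv[of "norm z" a] 0 a_less_1 by auto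
    moreover have "a ^ Suc n \<le> a ^ n" using a_pos a_less_1 by (simp add: mult_left_le_one_le)
    ultimately show ?case using small[of n z] 0 by simp
  next
    case (Suc n)
    have "R (hopf_map \<alpha> z)"
      using Suc.prems by (intro Suc.IH) (auto simp: norm_hopf_map algebra_simps)
    then show ?case using invariant Suc.prems(1) by blast
  qed
  obtain n where "a ^ n < 1 / norm z"
    using real_arch_pow_inv[of "1 / norm z" a] \<open>z \<noteq> 0\<close> a_less_1 by auto
  then have "a ^ n * norm z \<le> 1" using \<open>z \<noteq> 0\<close> by (simp add: field_simps)
  then show ?thesis using bounded \<open>z \<noteq> 0\<close> by blast
qed

lemma fd_equivariant:
  assumes f: "smooth_on (- {0}) f" and L: "bounded_linear L"
    and eq: "\<And>z. z \<noteq> 0 \<Longrightarrow> f (hopf_map \<alpha> z) = L (f z)" and z: "z \<noteq> 0"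
  shows "fd f (hopf_map \<alpha> z) (hopf_map \<alpha> v) = L (fd f z v)"
proof -
  have "(hopf_map \<alpha> has_derivative hopf_map \<alpha>) (at z)"
    by (rule bounded_linear_imp_has_derivative[OF bounded_linear_hopf_map])
  from diff_chain_at[OF this smooth_on_has_derivative[OF f, of "hopf_map \<alpha> z"]]
  have "(f \<circ> hopf_map \<alpha> has_derivative fd f (hopf_map \<alpha> z) \<circ> hopf_map \<alpha>) (at z)" using z by simp
  then have "((\<lambda>w. L (f w)) has_derivative fd f (hopf_map \<alpha> z) \<circ> hopf_map \<alpha>) (at z)"
    by (rule has_derivative_transform_within_open[of _ _ _ _ "- {0}"]) (use z eq in auto)
  moreover have "((\<lambda>w. L (f w)) has_derivative (\<lambda>v. L (fd f z v))) (at z)"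
    by (rule bounded_linear.has_derivative[OF L smooth_on_has_derivative[OF f]]) (use z in simp)
  ultimately have "fd f (hopf_map \<alpha> z) \<circ> hopf_map \<alpha> = (\<lambda>v. L (fd f z v))" by (rule has_derivative_unique)
  then show ?thesis by (metis comp_apply)
qed

section \<open>Vector fields\<close>

lemma hopf_fieldsD:
  assumes "X \<in> hopf_fields \<alpha>"
  shows "smooth_on (- {0}) X" "X 0 = 0" "\<And>z. z \<noteq> 0 \<Longrightarrow> X (hopf_map \<alpha> z) = hopf_map \<alpha> (X z)"
    and "\<And>z. z \<noteq> 0 \<Longrightarrow> (X has_derivative fd X z) (at z)"
    and "\<And>z v. z \<noteq> 0 \<Longrightarrow> fd X (hopf_map \<alpha> z) (hopf_map \<alpha> v) = hopf_map \<alpha> (fd X z v)"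
proof -
  show X: "smooth_on (- {0}) X" "X 0 = 0" and eq: "\<And>z. z \<noteq> 0 \<Longrightarrow> X (hopf_map \<alpha> z) = hopf_map \<alpha> (X z)"
    using assms by (auto simp: hopf_fields_def)
  show "(X has_derivative fd X z) (at z)" if "z \<noteq> 0" for z
    using smooth_on_has_derivative[OF X(1)] that by simp
  show "fd X (hopf_map \<alpha> z) (hopf_map \<alpha> v) = hopf_map \<alpha> (fd X z v)" if "z \<noteq> 0" for z v
    by (rule fd_equivariant[OF X(1) bounded_linear_hopf_map eq that])
qed

lemma hopf_fields_add: "X \<in> hopf_fields \<alpha> \<Longrightarrow> Y \<in> hopf_fields \<alpha> \<Longrightarrow> (\<lambda>z. X z + Y z) \<in> hopf_fields \<alpha>"
  by (auto simp: hopf_fields_def hopf_map_simps intro!: smooth_on_add)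

lemma hopf_fields_diff: "X \<in> hopf_fields \<alpha> \<Longrightarrow> Y \<in> hopf_fields \<alpha> \<Longrightarrow> (\<lambda>z. X z - Y z) \<in> hopf_fields \<alpha>"
  by (auto simp: hopf_fields_def hopf_map_simps intro!: smooth_on_diff)

lemma hopf_fields_J: "X \<in> hopf_fields \<alpha> \<Longrightarrow> Jf X \<in> hopf_fields \<alpha>"
  by (auto simp: hopf_fields_def J_simps J_hopf_map intro: smooth_on_J)

lemma hopf_fields_scale:
  "f \<in> hopf_functions \<alpha> \<Longrightarrow> X \<in> hopf_fields \<alpha> \<Longrightarrow> (\<lambda>z. f (hopf_orbit \<alpha> z) *\<^sub>R X z) \<in> hopf_fields \<alpha>"
  by (auto simp: hopf_fields_def hopf_functions_def hopf_map_simps hopf_orbit_hopf_map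
      intro!: smooth_on_scaleR)

lemma hopf_functions_const: "(\<lambda>q. c) \<in> hopf_functions \<alpha>"
  by (simp add: hopf_functions_def smooth_on_const)

lemma hopf_fields_J_iff [simp]: "Jf X \<in> hopf_fields \<alpha> \<longleftrightarrow> X \<in> hopf_fields \<alpha>"
proof
  assume "Jf X \<in> hopf_fields \<alpha>"
  from hopf_fields_scale[OF hopf_functions_const[of "-1"] hopf_fields_J[OF this]]
  show "X \<in> hopf_fields \<alpha>" by simp
qed (rule hopf_fields_J)

lemma hopf_field_with_value:
  assumes "z0 \<noteq> 0"
  obtains X where "X \<in> hopf_fields \<alpha>" "X z0 = v"
proof -
  \<comment> \<open>\<open>E i z\<close> is |z| to the power Ln(\<alpha>_i) / ln a. As |z| is
    multiplied by \<open>a\<close> under the deck map, \<open>E i\<close> is multiplied by exactly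
    the multiplier \<alpha>_i.\<close>
  define \<beta> where "\<beta> i = Ln (\<alpha> $ i) / (2 * ln a)" for i
  define E where "E i z = exp (\<beta> i * of_real (ln (z \<bullet> z)))" for i and z :: "complex^'n"
  define X where "X z = (if z = 0 then 0 else \<chi> i. v $ i / E i z0 * E i z)" for z :: "complex^'n"
  have "ln a \<noteq> 0" using a_pos a_less_1 by simp
  then have E: "E i (hopf_map \<alpha> z) = \<alpha> $ i * E i z" if "z \<noteq> 0" for i z
    using that a_pos
    by (simp add: E_def inner_hopf_map ln_mult ln_realpow distrib_left exp_add \<beta>_def)
  have "smooth_on (- {0}) (\<lambda>z. \<Sum>i\<in>UNIV. axis i (v $ i / E i z0 * E i z))"
  proof (intro smooth_on_sum smooth_on_linear_compose[of _ "axis _"])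
    show "bounded_linear (axis i :: complex \<Rightarrow> complex^'n)" for i
      by (rule linear_conv_bounded_linear[THEN iffD1], rule linearI)
        (auto simp: axis_def vec_eq_iff)
    show "smooth_on (- {0}) (\<lambda>z. v $ i / E i z0 * E i z)" for i
      unfolding E_def
      by (intro smooth_on_mult smooth_on_const smooth_on_exp_ln smooth_on_inner smooth_on_id) auto
  qed auto
  then have "smooth_on (- {0}) X"
    by (rule smooth_on_cong[rotated 2]) (auto simp: X_def vec_eq_iff axis_def sum.delta)
  then have "X \<in> hopf_fields \<alpha>"
    by (auto simp: hopf_fields_def X_def E) (simp add: hopf_map_def vec_eq_iff)
  moreover have "X z0 = v" using assms by (auto simp: X_def E_def vec_eq_iff)
  ultimately show thesis by (rule that)
qed

end

section \<open>A family of trilinear maps\<close>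

text \<open>With \<open>e\<close> the gradient of the logarithm of the conformal factor, the parameters \<open>(0, 0, 1)\<close> give
  the difference between the Levi-Civita connection and the flat one, \<open>(1, 0, 0)\<close> that of the Chern
  connection and \<open>(0, 1/2, 1/2)\<close> that of the Lichnerowicz connection.\<close>

definition conformal_term ::
  "real \<Rightarrow> real \<Rightarrow> real \<Rightarrow> complex^'n \<Rightarrow> complex^'n \<Rightarrow> complex^'n \<Rightarrow> complex^'n" where
  "conformal_term P Q K e u v = (e \<bullet> u) *\<^sub>R v - (P * (e \<bullet> J u)) *\<^sub>R J v
     + K *\<^sub>R ((e \<bullet> v) *\<^sub>R u - (u \<bullet> v) *\<^sub>R e) - Q *\<^sub>R ((e \<bullet> J v) *\<^sub>R J u - (u \<bullet> J v) *\<^sub>R J e)"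

lemma conformal_term_linear:
  "conformal_term P Q K (e + e') u v = conformal_term P Q K e u v + conformal_term P Q K e' u v"
  "conformal_term P Q K e (u + u') v = conformal_term P Q K e u v + conformal_term P Q K e u' v"
  "conformal_term P Q K e (u - u') v = conformal_term P Q K e u v - conformal_term P Q K e u' v"
  "conformal_term P Q K e u (v + v') = conformal_term P Q K e u v + conformal_term P Q K e u v'"
  "conformal_term P Q K e (c *\<^sub>R u) v = c *\<^sub>R conformal_term P Q K e u v"
  "conformal_term P Q K e u (c *\<^sub>R v) = c *\<^sub>R conformal_term P Q K e u v"
  by (simp_all add: conformal_term_def J_simps algebra_simps)

lemma has_derivative_conformal_term:
  assumes "(e has_derivative e') (at z)" "(u has_derivative u') (at z)" "(v has_derivative v') (at z)"
  shows "((\<lambda>z. conformal_term P Q K (e z) (u z) (v z)) has_derivative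
    (\<lambda>w. conformal_term P Q K (e' w) (u z) (v z) + conformal_term P Q K (e z) (u' w) (v z)
       + conformal_term P Q K (e z) (u z) (v' w))) (at z)"
proof -
  note dJ = bounded_linear.has_derivative[OF bounded_linear_J]
  show ?thesis
    unfolding conformal_term_def
    by (rule has_derivative_eq_rhs, (rule derivative_intros dJ assms)+)
       (simp add: J_simps algebra_simps)
qed

lemma smooth_on_conformal_term:
  assumes "open U" "smooth_on U e" "smooth_on U u" "smooth_on U v"
  shows "smooth_on U (\<lambda>z. conformal_term P Q K (e z) (u z) (v z))"
  unfolding conformal_term_def
  by (intro smooth_on_add smooth_on_diff smooth_on_scaleR smooth_on_inner smooth_on_mult smooth_on_const
      smooth_on_J assms)

text \<open>Apart from the first summand, each part of \<open>conformal_term\<close> is skew in its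
  last argument. The right side is the logarithmic derivative of the squared conformal factor, so
  for all \<open>P\<close>, \<open>Q\<close>, \<open>K\<close> the resulting connection is
  metric.\<close>

lemma conformal_term_metric:
  "conformal_term P Q K e x y \<bullet> z + y \<bullet> conformal_term P Q K e x z = 2 * (e \<bullet> x) * (y \<bullet> z)"
proof -
  have "J y \<bullet> z = - (y \<bullet> J z)" "J x \<bullet> z = - (x \<bullet> J z)" "J e \<bullet> z = - (e \<bullet> J z)"
    "y \<bullet> J x = - (x \<bullet> J y)" "y \<bullet> J e = - (e \<bullet> J y)" "y \<bullet> x = x \<bullet> y" "y \<bullet> e = e \<bullet> y"
    using inner_J_left inner_commute by metis+
  then show ?thesis
    by (simp add: conformal_term_def inner_add_left inner_add_right inner_diff_left inner_diff_right)
      (simp add: algebra_simps)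
qed

text \<open>\<open>h\<close> and \<open>h'\<close> stand for the derivatives of \<open>e\<close>
  along \<open>x\<close> and \<open>J x\<close>; their terms carry the factor
  \<open>P + Q + K\<close>, which is where the sum 1 enters. The last bracket is |x|^2 times the
  squared length of the part of \<open>e\<close> orthogonal to \<open>x\<close> and
  \<open>J x\<close>.\<close>

lemma conformal_term_curvature:
  assumes "P + Q + K = 1"
  shows "(conformal_term P Q K h (J x) (J x) - conformal_term P Q K h' x (J x)
      + conformal_term P Q K e x (conformal_term P Q K e (J x) (J x))
      - conformal_term P Q K e (J x) (conformal_term P Q K e x (J x))) \<bullet> x =
    - (x \<bullet> x) * (h \<bullet> x + h' \<bullet> J x + (K\<^sup>2 + Q\<^sup>2) * ((e \<bullet> e) * (x \<bullet> x) - (e \<bullet> x)\<^sup>2 - (e \<bullet> J x)\<^sup>2))"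
proof -
  have P: "P = 1 - Q - K" using assms by simp
  have c: "x \<bullet> e = e \<bullet> x" "J x \<bullet> e = e \<bullet> J x" "J e \<bullet> x = - (e \<bullet> J x)" "x \<bullet> J e = - (e \<bullet> J x)"
    "J h' \<bullet> x = - (h' \<bullet> J x)" "J h \<bullet> x = - (h \<bullet> J x)" "e \<bullet> J e = 0"
    using inner_J_left inner_commute inner_J_self by metis+
  show ?thesis
    by (simp add: conformal_term_def J_simps inner_add_left inner_add_right inner_diff_left inner_diff_right c P)
      (simp add: algebra_simps power2_eq_square)
qed

section \<open>Connections of conformally flat Hermitian metrics\<close>

definition grad :: "('a::euclidean_space \<Rightarrow> real) \<Rightarrow> 'a \<Rightarrow> 'a" where
  "grad p z = (\<Sum>b\<in>Basis. fd p z b *\<^sub>R b)"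

lemma inner_grad:
  assumes "smooth_on U p" "z \<in> U"
  shows "grad p z \<bullet> v = fd p z v"
  unfolding linear_eq_sum_Basis[OF smooth_on_linear_fd[OF assms], of v] grad_def inner_sum_left
  by (simp add: inner_commute mult.commute)

lemma smooth_on_grad: "open U \<Longrightarrow> smooth_on U p \<Longrightarrow> smooth_on U (grad p)"
  unfolding grad_def[abs_def] by (intro smooth_on_sum smooth_on_scaleR smooth_on_fd smooth_on_const)

lemma fd_grad_symmetric:
  assumes "open U" "smooth_on U p" "z \<in> U"
  shows "fd (grad p) z u \<bullet> v = fd (grad p) z v \<bullet> u"
proof -
  have *: "fd (\<lambda>w. fd p w v) z u = fd (grad p) z u \<bullet> v" for u v
  proof -
    have "fd (\<lambda>w. fd p w v) z = fd (\<lambda>w. grad p w \<bullet> v) z"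
      by (rule fd_cong[OF assms(1,3)]) (simp add: inner_grad[OF assms(2)])
    also have "\<dots> = (\<lambda>u. fd (grad p) z u \<bullet> v)"
      by (rule fd_linear_compose[OF bounded_linear_inner_left smooth_on_grad[OF assms(1,2)] assms(3)])
    finally show ?thesis by simp
  qed
  show ?thesis using second_derivative_symmetric_real[OF assms, of v u] by (simp add: *)
qed

locale hopf_conformal = isosceles_hopf \<alpha> a for \<alpha> :: "complex^'n" and a +
  fixes p :: "complex^'n \<Rightarrow> real" and g :: "'n tensor2"
  assumes p_smooth: "smooth_on (- {0}) p"
    and p_pos: "\<And>z. z \<noteq> 0 \<Longrightarrow> 0 < p z"
    and p_hopf: "\<And>z. z \<noteq> 0 \<Longrightarrow> p (hopf_map \<alpha> z) = a\<^sup>2 * p z"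
    and g_eq: "\<And>z u v. z \<noteq> 0 \<Longrightarrow> g z u v = (u \<bullet> v) / p z"
begin

lemma g_simps:
  assumes "z \<noteq> 0"
  shows "g z (u - u') v = g z u v - g z u' v"
    "g z u v = g z v u" "g z (J u) v = - g z u (J v)" "g z u u = 0 \<longleftrightarrow> u = 0"
  using p_pos[OF assms]
  by (simp_all add: g_eq[OF assms] inner_add_left inner_diff_left inner_add_right inner_diff_right
      add_divide_distrib diff_divide_distrib inner_J_left) (simp_all add: inner_commute)

lemma grad_hopf: "z \<noteq> 0 \<Longrightarrow> grad p (hopf_map \<alpha> z) = hopf_map \<alpha> (grad p z)"
proof -
  assume z: "z \<noteq> 0"
  have "grad p (hopf_map \<alpha> z) \<bullet> v = hopf_map \<alpha> (grad p z) \<bullet> v" for v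
  proof -
    obtain u where u: "v = hopf_map \<alpha> u" using hopf_map_surj by metis
    have "grad p (hopf_map \<alpha> z) \<bullet> v = fd p (hopf_map \<alpha> z) (hopf_map \<alpha> u)"
      unfolding u using z by (intro inner_grad[OF p_smooth]) simp
    also have "\<dots> = a\<^sup>2 * fd p z u"
      by (rule fd_equivariant[OF p_smooth bounded_linear_mult_right p_hopf z])
    also have "\<dots> = hopf_map \<alpha> (grad p z) \<bullet> v"
      using z by (simp add: u inner_hopf_map inner_grad[OF p_smooth])
    finally show ?thesis .
  qed
  then show ?thesis using vector_eq_rdot by blast
qed

text \<open>The gradient of the logarithm of the conformal factor \<open>p\<^sup>-\<^sup>1\<^sup>/\<^sup>2\<close> of the metric.\<close>

definition G :: "complex^'n \<Rightarrow> complex^'n" where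
  "G z = (- inverse (2 * p z)) *\<^sub>R grad p z"

lemma smooth_grad: "smooth_on (- {0}) (grad p)"
  by (rule smooth_on_grad[OF _ p_smooth]) auto

lemma smooth_inverse_p: "smooth_on (- {0}) (\<lambda>z. inverse (p z))"
  by (rule smooth_on_inverse[OF _ p_smooth]) (auto simp: p_pos)

lemma smooth_G: "smooth_on (- {0}) G"
proof -
  have "smooth_on (- {0}) (\<lambda>z. ((- 1 / 2) * inverse (p z)) *\<^sub>R grad p z)"
    by (intro smooth_on_scaleR smooth_on_mult smooth_on_const smooth_inverse_p smooth_grad) auto
  then show ?thesis unfolding G_def[abs_def] by (simp add: mult.commute)
qed

text \<open>\<open>ln p\<close> changes by a constant, so its differential is invariant. The factor
  appears on turning it into a vector with the Euclidean inner product, which scales by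
  \<open>a\<^sup>2\<close>.\<close>

lemma G_hopf: "z \<noteq> 0 \<Longrightarrow> G (hopf_map \<alpha> z) = inverse (a\<^sup>2) *\<^sub>R hopf_map \<alpha> (G z)"
  by (simp add: G_def p_hopf grad_hopf hopf_map_simps)

lemma inner_G: "z \<noteq> 0 \<Longrightarrow> G z \<bullet> v = - fd p z v / (2 * p z)"
  by (simp add: G_def inner_grad[OF p_smooth] field_simps)

text \<open>The zero values repeat the convention of \<open>affine_connection\<close>; without them
  equality with the connections given by \<open>THE\<close> would fail outside the invariant
  fields.\<close>

definition conformal_connection :: "real \<Rightarrow> real \<Rightarrow> real \<Rightarrow> 'n connection" where
  "conformal_connection P Q K X Y = (\<lambda>z. if z = 0 \<or> X \<notin> hopf_fields \<alpha> \<or> Y \<notin> hopf_fields \<alpha> then 0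
     else fd Y z (X z) + conformal_term P Q K (G z) (X z) (Y z))"

lemma conformal_term_hopf:
  "conformal_term P Q K (inverse (a\<^sup>2) *\<^sub>R hopf_map \<alpha> e) (hopf_map \<alpha> u) (hopf_map \<alpha> v)
     = hopf_map \<alpha> (conformal_term P Q K e u v)"
proof -
  have c: "inverse (a\<^sup>2) * (a\<^sup>2 * x) = x" "a\<^sup>2 * x * inverse (a\<^sup>2) = x" for x
    using a_pos by simp_all
  show ?thesis by (simp add: c conformal_term_def J_hopf_map J_simps hopf_map_simps inner_hopf_map)
qed

lemma conformal_connection_field:
  assumes X: "X \<in> hopf_fields \<alpha>" and Y: "Y \<in> hopf_fields \<alpha>"
  shows "conformal_connection P Q K X Y \<in> hopf_fields \<alpha>"
proof -
  have "smooth_on (- {0}) (\<lambda>z. fd Y z (X z) + conformal_term P Q K (G z) (X z) (Y z))"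
    using hopf_fieldsD(1)[OF X] hopf_fieldsD(1)[OF Y]
    by (intro smooth_on_add smooth_on_fd_apply smooth_on_conformal_term smooth_G) auto
  then have "smooth_on (- {0}) (conformal_connection P Q K X Y)"
    by (rule smooth_on_cong[rotated 2]) (auto simp: conformal_connection_def X Y)
  moreover have "conformal_connection P Q K X Y (hopf_map \<alpha> z) = hopf_map \<alpha> (conformal_connection P Q K X Y z)"
    if "z \<noteq> 0" for z
    using that hopf_fieldsD(3)[OF X that] hopf_fieldsD(3)[OF Y that] hopf_fieldsD(5)[OF Y that]
    by (simp add: conformal_connection_def X Y G_hopf conformal_term_hopf hopf_map_simps)
  ultimately show ?thesis by (simp add: hopf_fields_def conformal_connection_def)
qed

lemma conformal_connection_affine: "affine_connection \<alpha> (conformal_connection P Q K)"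
  unfolding affine_connection_def
proof (intro conjI ballI allI impI)
  let ?D = "conformal_connection P Q K"
  show "?D X Y = (\<lambda>z. 0)" if "X \<notin> hopf_fields \<alpha> \<or> Y \<notin> hopf_fields \<alpha>" for X Y
    using that by (auto simp: conformal_connection_def)
  fix X Y assume X: "X \<in> hopf_fields \<alpha>" and Y: "Y \<in> hopf_fields \<alpha>"
  show "?D X Y \<in> hopf_fields \<alpha>" by (rule conformal_connection_field[OF X Y])
  have lin: "linear (fd Y z)" if "z \<noteq> 0" for z
    by (rule has_derivative_linear[OF hopf_fieldsD(4)[OF Y that]])
  show "?D (\<lambda>z. X z + X' z) Y = (\<lambda>z. ?D X Y z + ?D X' Y z)" if "X' \<in> hopf_fields \<alpha>" for X'
    using X Y that
    by (auto simp: conformal_connection_def hopf_fields_add conformal_term_linear linear_add[OF lin])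
  show "?D X (\<lambda>z. Y z + Y' z) = (\<lambda>z. ?D X Y z + ?D X Y' z)" if Y': "Y' \<in> hopf_fields \<alpha>" for Y'
  proof
    fix z
    show "?D X (\<lambda>z. Y z + Y' z) z = ?D X Y z + ?D X Y' z"
    proof (cases "z = 0")
      case False
      have "fd (\<lambda>z. Y z + Y' z) z = (\<lambda>v. fd Y z v + fd Y' z v)"
        by (rule fd_eqI[OF has_derivative_add[OF hopf_fieldsD(4)[OF Y False] hopf_fieldsD(4)[OF Y' False]]])
      then show ?thesis
        using X Y Y' False by (simp add: conformal_connection_def hopf_fields_add conformal_term_linear)
    qed (simp add: conformal_connection_def)
  qed
  fix f assume f: "f \<in> hopf_functions \<alpha>"
  show "?D (\<lambda>z. f (hopf_orbit \<alpha> z) *\<^sub>R X z) Y = (\<lambda>z. f (hopf_orbit \<alpha> z) *\<^sub>R ?D X Y z)"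
    using X Y f hopf_fields_scale[OF f X]
    by (auto simp: conformal_connection_def conformal_term_linear linear_scale[OF lin] scaleR_add_right)
  fix z :: "complex^'n" assume z: "z \<noteq> 0"
  have "((\<lambda>w. f (hopf_orbit \<alpha> w)) has_derivative fd (\<lambda>w. f (hopf_orbit \<alpha> w)) z) (at z)"
    using f z by (intro smooth_on_has_derivative[of "- {0}"]) (auto simp: hopf_functions_def)
  from fd_eqI[OF has_derivative_scaleR[OF this hopf_fieldsD(4)[OF Y z]]]
  show "?D X (\<lambda>z. f (hopf_orbit \<alpha> z) *\<^sub>R Y z) z = f (hopf_orbit \<alpha> z) *\<^sub>R ?D X Y z +
      fd (\<lambda>w. f (hopf_orbit \<alpha> w)) z (X z) *\<^sub>R Y z"
    using X Y z hopf_fields_scale[OF f Y]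
    by (simp add: conformal_connection_def conformal_term_linear scaleR_add_right)
qed

lemma conformal_connection_metric: "metric_connection \<alpha> g (conformal_connection P Q K)"
  unfolding metric_connection_def
proof (intro ballI allI impI)
  fix X Y Z :: "complex^'n \<Rightarrow> complex^'n" and z :: "complex^'n"
  assume X: "X \<in> hopf_fields \<alpha>" and Y: "Y \<in> hopf_fields \<alpha>" and Z: "Z \<in> hopf_fields \<alpha>" and z: "z \<noteq> 0"
  have "((\<lambda>w. (Y w \<bullet> Z w) / p w) has_derivative
      (\<lambda>v. - (Y z \<bullet> Z z) * (inverse (p z) * fd p z v * inverse (p z)) + (Y z \<bullet> fd Z z v + fd Y z v \<bullet> Z z) / p z)) (at z)"
    using hopf_fieldsD(4)[OF Y z] hopf_fieldsD(4)[OF Z z] smooth_on_has_derivative[OF p_smooth, of z] z p_pos[OF z]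
    by (intro has_derivative_divide has_derivative_inner) auto
  moreover have "fd (\<lambda>w. g w (Y w) (Z w)) z = fd (\<lambda>w. (Y w \<bullet> Z w) / p w) z"
    by (rule fd_cong[of "- {0}"]) (use z g_eq in auto)
  ultimately have "fd (\<lambda>w. g w (Y w) (Z w)) z (X z) =
      (fd Y z (X z) \<bullet> Z z + Y z \<bullet> fd Z z (X z)) / p z + 2 * (G z \<bullet> X z) * (Y z \<bullet> Z z) / p z"
    using p_pos[OF z] z by (simp add: fd_eqI inner_G field_simps)
  then show "fd (\<lambda>w. g w (Y w) (Z w)) z (X z) =
      g z (conformal_connection P Q K X Y z) (Z z) + g z (Y z) (conformal_connection P Q K X Z z)"
    unfolding conformal_term_metric[of P Q K "G z" "X z" "Y z" "Z z", symmetric]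
    using X Y Z z
    by (simp add: conformal_connection_def g_eq inner_add_left inner_add_right add_divide_distrib)
qed

section \<open>Identification of the Levi-Civita, Chern and canonical connections\<close>

lemma fd_J:
  assumes "X \<in> hopf_fields \<alpha>" "z \<noteq> 0"
  shows "fd (Jf X) z v = J (fd X z v)"
  using fd_linear_compose[OF bounded_linear_J hopf_fieldsD(1)[OF assms(1)], of z] assms(2) by simp

text \<open>Uniqueness: the difference \<open>B\<close> of two candidates is symmetric in its
  arguments and each \<open>B X\<close> is skew for \<open>g\<close>. Cyclic permutation then gives
  g(B X Y, Z) = 0, and \<open>B X Y\<close> is itself an invariant field that may be taken for
  \<open>Z\<close>.\<close>

lemma levi_civita_eq: "levi_civita \<alpha> g = conformal_connection 0 0 1"
  unfolding levi_civita_def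
proof (rule the_equality, intro conjI ballI)
  show "affine_connection \<alpha> (conformal_connection 0 0 1)" by (rule conformal_connection_affine)
  show "metric_connection \<alpha> g (conformal_connection 0 0 1)" by (rule conformal_connection_metric)
  show "torsion (conformal_connection 0 0 1) X Y = (\<lambda>z. 0)"
    if "X \<in> hopf_fields \<alpha>" "Y \<in> hopf_fields \<alpha>" for X Y
    using that
    by (auto simp: torsion_def conformal_connection_def lie_bracket_def conformal_term_def inner_commute)
next
  fix D
  assume "affine_connection \<alpha> D \<and> metric_connection \<alpha> g D \<and>
    (\<forall>X\<in>hopf_fields \<alpha>. \<forall>Y\<in>hopf_fields \<alpha>. torsion D X Y = (\<lambda>z. 0))"
  then have aff: "affine_connection \<alpha> D" and met: "metric_connection \<alpha> g D"
    and tor: "\<And>X Y. X \<in> hopf_fields \<alpha> \<Longrightarrow> Y \<in> hopf_fields \<alpha> \<Longrightarrow> torsion D X Y = (\<lambda>z. 0)" by auto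
  let ?E = "conformal_connection 0 0 1"
  define B where "B X Y = (\<lambda>z. D X Y z - ?E X Y z)" for X Y
  have field: "D X Y \<in> hopf_fields \<alpha>" if "X \<in> hopf_fields \<alpha>" "Y \<in> hopf_fields \<alpha>" for X Y
    using aff that unfolding affine_connection_def by blast
  have B_field: "B X Y \<in> hopf_fields \<alpha>" if "X \<in> hopf_fields \<alpha>" "Y \<in> hopf_fields \<alpha>" for X Y
    unfolding B_def by (intro hopf_fields_diff field conformal_connection_field that)
  have B_sym: "B X Y z = B Y X z" if "X \<in> hopf_fields \<alpha>" "Y \<in> hopf_fields \<alpha>" "z \<noteq> 0" for X Y z
  proof -
    have "torsion D X Y z = 0" using tor that by simp
    moreover have "?E X Y z - ?E Y X z - lie_bracket X Y z = 0"
      using that by (simp add: conformal_connection_def lie_bracket_def conformal_term_def inner_commute)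
    ultimately show ?thesis by (simp add: B_def torsion_def algebra_simps)
  qed
  have B_skew: "g z (B X Y z) (Z z) = - g z (B X Z z) (Y z)"
    if "X \<in> hopf_fields \<alpha>" "Y \<in> hopf_fields \<alpha>" "Z \<in> hopf_fields \<alpha>" "z \<noteq> 0" for X Y Z z
    using met conformal_connection_metric[of 0 0 1] that g_simps(2)[OF that(4)]
    unfolding metric_connection_def B_def g_simps(1)[OF that(4)] by (smt (verit))
  have B_zero: "B X Y z = 0" if X: "X \<in> hopf_fields \<alpha>" and Y: "Y \<in> hopf_fields \<alpha>" for X Y z
  proof (cases "z = 0")
    case True
    then show ?thesis using hopf_fieldsD(2)[OF B_field[OF X Y]] by simp
  next
    case False
    have "g z (B X Y z) (Z z) = 0" if Z: "Z \<in> hopf_fields \<alpha>" for Z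
      using B_skew[OF X Y Z False] B_skew[OF Y Z X False] B_skew[OF Z X Y False]
        B_sym[OF X Y False] B_sym[OF Y Z False] B_sym[OF Z X False] by simp
    from this[OF B_field[OF X Y]] show ?thesis using g_simps(4)[OF False] by simp
  qed
  show "D = ?E"
  proof (intro ext)
    fix X Y z
    show "D X Y z = ?E X Y z"
    proof (cases "X \<in> hopf_fields \<alpha> \<and> Y \<in> hopf_fields \<alpha>")
      case True
      then show ?thesis using B_zero[of X Y z] by (simp add: B_def)
    next
      case False
      then have "D X Y = (\<lambda>z. 0)" using aff unfolding affine_connection_def by blast
      then show ?thesis using False by (auto simp: conformal_connection_def)
    qed
  qed
qed

text \<open>Uniqueness: the difference \<open>B\<close> is complex linear in its second argument
  since both connections are complex. Equality of the (1,1) parts of the torsions makes it complex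
  linear in the first argument too, and this is incompatible with being skew for \<open>g\<close>
  unless it vanishes.\<close>

lemma chern_eq: "chern \<alpha> g = conformal_connection 1 0 0"
  unfolding chern_def
proof (rule the_equality, intro conjI ballI)
  let ?E = "conformal_connection 1 0 0"
  show "affine_connection \<alpha> ?E" by (rule conformal_connection_affine)
  show "metric_connection \<alpha> g ?E" by (rule conformal_connection_metric)
  show E_J: "complex_connection \<alpha> ?E"
    unfolding complex_connection_def
    by (auto simp: conformal_connection_def fd_J conformal_term_def J_simps)
  show E_tor: "part11 (torsion ?E) X Y = (\<lambda>z. 0)"
    if "X \<in> hopf_fields \<alpha>" "Y \<in> hopf_fields \<alpha>" for X Y
    using that
    by (auto simp: part11_def torsion_def conformal_connection_def lie_bracket_def conformal_term_def
        fd_J algebra_simps)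
  fix D
  assume "affine_connection \<alpha> D \<and> metric_connection \<alpha> g D \<and> complex_connection \<alpha> D \<and>
    (\<forall>X\<in>hopf_fields \<alpha>. \<forall>Y\<in>hopf_fields \<alpha>. part11 (torsion D) X Y = (\<lambda>z. 0))"
  then have aff: "affine_connection \<alpha> D" and met: "metric_connection \<alpha> g D"
    and D_J: "complex_connection \<alpha> D"
    and tor: "\<And>X Y. X \<in> hopf_fields \<alpha> \<Longrightarrow> Y \<in> hopf_fields \<alpha> \<Longrightarrow> part11 (torsion D) X Y = (\<lambda>z. 0)" by auto
  define B where "B X Y = (\<lambda>z. D X Y z - ?E X Y z)" for X Y
  have field: "D X Y \<in> hopf_fields \<alpha>" if "X \<in> hopf_fields \<alpha>" "Y \<in> hopf_fields \<alpha>" for X Y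
    using aff that unfolding affine_connection_def by blast
  have B_field: "B X Y \<in> hopf_fields \<alpha>" if "X \<in> hopf_fields \<alpha>" "Y \<in> hopf_fields \<alpha>" for X Y
    unfolding B_def by (intro hopf_fields_diff field conformal_connection_field that)
  have B_J: "B X (Jf Y) z = J (B X Y z)" if "X \<in> hopf_fields \<alpha>" "Y \<in> hopf_fields \<alpha>" for X Y z
    using D_J E_J that unfolding complex_connection_def B_def by (simp add: J_simps)
  have minus: "F (\<lambda>z. - X z) Y z = - F X Y z"
    if "affine_connection \<alpha> F" "X \<in> hopf_fields \<alpha>" "Y \<in> hopf_fields \<alpha>" for F :: "'n connection" and X Y z
  proof -
    have "\<forall>f\<in>hopf_functions \<alpha>. \<forall>X\<in>hopf_fields \<alpha>. \<forall>Y\<in>hopf_fields \<alpha>.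
        F (\<lambda>z. f (hopf_orbit \<alpha> z) *\<^sub>R X z) Y = (\<lambda>z. f (hopf_orbit \<alpha> z) *\<^sub>R F X Y z)"
      using that(1) unfolding affine_connection_def by (elim conjE)
    from this[rule_format, OF hopf_functions_const[of "-1"] that(2,3)] show ?thesis by simp
  qed
  have B_minus: "B (\<lambda>z. - X z) Y z = - B X Y z" if "X \<in> hopf_fields \<alpha>" "Y \<in> hopf_fields \<alpha>" for X Y z
    using minus[OF aff that] minus[OF conformal_connection_affine that] by (simp add: B_def)
  have B_part: "B X Y z + J (B (Jf X) Y z) = B Y X z + J (B (Jf Y) X z)"
    if "X \<in> hopf_fields \<alpha>" "Y \<in> hopf_fields \<alpha>" for X Y z
  proof -
    have "part11 (torsion D) X Y z = part11 (torsion ?E) X Y z" using tor E_tor that by simp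
    then have "torsion D X Y z + torsion D (Jf X) (Jf Y) z = torsion ?E X Y z + torsion ?E (Jf X) (Jf Y) z"
      unfolding part11_def scaleR_cancel_left by simp
    then have "B X Y z + B (Jf X) (Jf Y) z = B Y X z + B (Jf Y) (Jf X) z"
      by (simp add: torsion_def B_def algebra_simps)
    then show ?thesis using B_J that by simp
  qed
  have B_JX: "B (Jf X) Y z = J (B X Y z)" if X: "X \<in> hopf_fields \<alpha>" and Y: "Y \<in> hopf_fields \<alpha>" for X Y z
  proof -
    \<comment> \<open>\<open>C\<close> is twice the part of \<open>B\<close> that is antilinear in
      \<open>X\<close>. It is symmetric but linear in \<open>Y\<close>, hence zero.\<close>
    define C where "C X Y = B X Y z + J (B (Jf X) Y z)" for X Y
    have C_sym: "C X Y = C Y X" if "X \<in> hopf_fields \<alpha>" "Y \<in> hopf_fields \<alpha>" for X Y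
      unfolding C_def by (rule B_part[OF that])
    have C1: "C (Jf X) Y = - J (C X Y)" and C2: "C X (Jf Y) = J (C X Y)"
      if "X \<in> hopf_fields \<alpha>" "Y \<in> hopf_fields \<alpha>" for X Y
      using that B_minus B_J by (simp_all add: C_def J_simps)
    have "J (C X Y) = - J (C X Y)"
      using C2[OF X Y] C_sym[OF X, of "Jf Y"] C1[OF Y X] C_sym[OF X Y] Y by simp
    then have "J (C X Y) = 0"
      using scaleR_2[of "J (C X Y)"] by (metis add.right_inverse scaleR_eq_0_iff zero_neq_numeral)
    then have "B X Y z = - J (B (Jf X) Y z)" by (simp add: C_def add_eq_0_iff2)
    then have "J (B X Y z) = - J (J (B (Jf X) Y z))" by (simp add: J_simps)
    then show ?thesis by simp
  qed
  have B_skew: "g z (B X Y z) (Z z) = - g z (B X Z z) (Y z)"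
    if "X \<in> hopf_fields \<alpha>" "Y \<in> hopf_fields \<alpha>" "Z \<in> hopf_fields \<alpha>" "z \<noteq> 0" for X Y Z z
    using met conformal_connection_metric[of 1 0 0] that g_simps(2)[OF that(4)]
    unfolding metric_connection_def B_def g_simps(1)[OF that(4)] by (smt (verit))
  have B_zero: "B X Y z = 0" if X: "X \<in> hopf_fields \<alpha>" and Y: "Y \<in> hopf_fields \<alpha>" for X Y z
  proof (cases "z = 0")
    case True
    then show ?thesis using hopf_fieldsD(2)[OF B_field[OF X Y]] by simp
  next
    case False
    \<comment> \<open>\<open>B X\<close> is skew and commutes with \<open>J\<close>, so
      \<open>J\<close> composed with it is symmetric for \<open>g\<close>; but that composition is
      \<open>B (Jf X)\<close>, which is skew.\<close>
    have "g z (J (B X Y z)) (Z z) = 0" if Z: "Z \<in> hopf_fields \<alpha>" for Z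
    proof -
      have "g z (J (B X Y z)) (Z z) = - g z (B X Y z) (J (Z z))" by (rule g_simps(3)[OF False])
      also have "\<dots> = g z (J (B X Z z)) (Y z)"
        using B_skew[OF X Y hopf_fields_J[OF Z] False] B_J[OF X Z] by simp
      also have "\<dots> = - g z (J (B X Y z)) (Z z)"
        using B_skew[OF hopf_fields_J[OF X] Z Y False] B_JX[OF X] Y Z by simp
      finally show ?thesis by simp
    qed
    from this[OF hopf_fields_J[OF B_field[OF X Y]]] show ?thesis using g_simps(4)[OF False] by simp
  qed
  show "D = ?E"
  proof (intro ext)
    fix X Y z
    show "D X Y z = ?E X Y z"
    proof (cases "X \<in> hopf_fields \<alpha> \<and> Y \<in> hopf_fields \<alpha>")
      case True
      then show ?thesis using B_zero[of X Y z] by (simp add: B_def)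
    next
      case False
      then have "D X Y = (\<lambda>z. 0)" using aff unfolding affine_connection_def by blast
      then show ?thesis using False by (auto simp: conformal_connection_def)
    qed
  qed
qed

text \<open>The parameters combine affinely, as (1-s) (t (1,0,0) + (1-t) (0,1/2,1/2)) + s (0,0,1).
  In particular their sum remains 1.\<close>

lemma canonical_connection_eq:
  "canonical_connection \<alpha> g t s =
    conformal_connection ((1 - s) * t) ((1 - s) * (1 - t) / 2) ((1 - s) * (1 - t) / 2 + s)"
proof (intro ext)
  fix X Y z
  have arith: "(1 - s) *\<^sub>R (t *\<^sub>R (D + conformal_term 1 0 0 e x y)
        + (1 - t) *\<^sub>R ((1/2) *\<^sub>R (D + conformal_term 0 0 1 e x y - J (J D + conformal_term 0 0 1 e x (J y)))))
      + s *\<^sub>R (D + conformal_term 0 0 1 e x y)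
    = D + conformal_term ((1 - s) * t) ((1 - s) * (1 - t) / 2) ((1 - s) * (1 - t) / 2 + s) e x y"
    for D e x y :: "complex^'n"
    by (rule vector_eq_rdot[THEN iffD1], rule allI)
      (simp only: conformal_term_def J_simps J_J inner_add_left inner_diff_left inner_scaleR_left
          inner_minus_left inner_minus_right,
        simp add: algebra_simps add_divide_distrib diff_divide_distrib)
  show "canonical_connection \<alpha> g t s X Y z =
    conformal_connection ((1 - s) * t) ((1 - s) * (1 - t) / 2) ((1 - s) * (1 - t) / 2 + s) X Y z"
  proof (cases "z = 0 \<or> X \<notin> hopf_fields \<alpha> \<or> Y \<notin> hopf_fields \<alpha>")
    case True
    then show ?thesis
      by (auto simp: canonical_connection_def gauduchon_def lichnerowicz_def levi_civita_eq chern_eq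
          conformal_connection_def J_simps)
  next
    case False
    then show ?thesis
      using arith[of "fd Y z (X z)" "G z" "X z" "Y z"]
      by (simp add: canonical_connection_def gauduchon_def lichnerowicz_def levi_civita_eq chern_eq
          conformal_connection_def fd_J)
  qed
qed

section \<open>Curvature\<close>

lemma fd_conformal_connection:
  assumes Y: "Y \<in> hopf_fields \<alpha>" and Z: "Z \<in> hopf_fields \<alpha>" and z: "z \<noteq> 0"
  shows "fd (conformal_connection P Q K Y Z) z v =
    fd (\<lambda>w. fd Z w (Y z)) z v + fd Z z (fd Y z v)
    + (conformal_term P Q K (fd G z v) (Y z) (Z z) + conformal_term P Q K (G z) (fd Y z v) (Z z)
      + conformal_term P Q K (G z) (Y z) (fd Z z v))"
proof -
  have "fd (conformal_connection P Q K Y Z) z =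
      fd (\<lambda>w. fd Z w (Y w) + conformal_term P Q K (G w) (Y w) (Z w)) z"
    by (rule fd_cong[of "- {0}"]) (use z Y Z in \<open>auto simp: conformal_connection_def\<close>)
  also have "\<dots> = (\<lambda>v. fd (\<lambda>w. fd Z w (Y z)) z v + fd Z z (fd Y z v)
    + (conformal_term P Q K (fd G z v) (Y z) (Z z) + conformal_term P Q K (G z) (fd Y z v) (Z z)
      + conformal_term P Q K (G z) (Y z) (fd Z z v)))"
    using z
    by (intro fd_eqI has_derivative_add has_derivative_conformal_term hopf_fieldsD(4)[OF Y z]
        hopf_fieldsD(4)[OF Z z] smooth_on_has_derivative[OF smooth_G]
        has_derivative_fd_apply[of "- {0}", OF _ hopf_fieldsD(1)[OF Z]]) auto
  finally show ?thesis by simp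
qed

lemma lie_bracket_field:
  assumes X: "X \<in> hopf_fields \<alpha>" and Y: "Y \<in> hopf_fields \<alpha>"
  shows "lie_bracket X Y \<in> hopf_fields \<alpha>"
proof -
  have "smooth_on (- {0}) (\<lambda>z. fd Y z (X z) - fd X z (Y z))"
    by (intro smooth_on_diff smooth_on_fd_apply hopf_fieldsD[OF X] hopf_fieldsD[OF Y]) auto
  then have "smooth_on (- {0}) (lie_bracket X Y)"
    by (rule smooth_on_cong[rotated 2]) (auto simp: lie_bracket_def)
  then show ?thesis
    using hopf_fieldsD(3,5)[OF X] hopf_fieldsD(3,5)[OF Y]
    by (simp add: hopf_fields_def lie_bracket_def hopf_map_simps)
qed

text \<open>The flat connection has no curvature: second derivatives of \<open>Z\<close> cancel by
  symmetry, and first derivatives of \<open>X\<close>, \<open>Y\<close>, \<open>Z\<close> cancel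
  against each other and the bracket term. What is left is the derivative of the trilinear term
  through \<open>G\<close> and its commutator.\<close>

lemma curvature_conformal_connection:
  assumes X: "X \<in> hopf_fields \<alpha>" and Y: "Y \<in> hopf_fields \<alpha>" and Z: "Z \<in> hopf_fields \<alpha>" and z: "z \<noteq> 0"
  shows "curvature (conformal_connection P Q K) X Y Z z =
    conformal_term P Q K (fd G z (X z)) (Y z) (Z z) - conformal_term P Q K (fd G z (Y z)) (X z) (Z z)
    + conformal_term P Q K (G z) (X z) (conformal_term P Q K (G z) (Y z) (Z z))
    - conformal_term P Q K (G z) (Y z) (conformal_term P Q K (G z) (X z) (Z z))"
proof -
  let ?D = "conformal_connection P Q K"
  have twice: "?D X (?D Y Z) z = fd (?D Y Z) z (X z) + conformal_term P Q K (G z) (X z) (?D Y Z z)"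
    if "X \<in> hopf_fields \<alpha>" "Y \<in> hopf_fields \<alpha>" for X Y
    using conformal_connection_field[OF that(2) Z] that z
    by (subst (1) conformal_connection_def) simp
  have DY: "?D Y Z z = fd Z z (Y z) + conformal_term P Q K (G z) (Y z) (Z z)" if "Y \<in> hopf_fields \<alpha>" for Y
    using that Z z by (simp add: conformal_connection_def)
  have bracket: "?D (lie_bracket X Y) Z z = fd Z z (fd Y z (X z)) - fd Z z (fd X z (Y z))
      + conformal_term P Q K (G z) (fd Y z (X z) - fd X z (Y z)) (Z z)"
    using lie_bracket_field[OF X Y] Z z
    by (simp add: conformal_connection_def lie_bracket_def
        linear_diff[OF has_derivative_linear[OF hopf_fieldsD(4)[OF Z z]]])
  have sym: "fd (\<lambda>w. fd Z w (Y z)) z (X z) = fd (\<lambda>w. fd Z w (X z)) z (Y z)"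
    by (rule second_derivative_symmetric[of "- {0}", OF _ hopf_fieldsD(1)[OF Z]]) (use z in auto)
  show ?thesis
    unfolding curvature_def twice[OF X Y] twice[OF Y X] DY[OF X] DY[OF Y] bracket
      fd_conformal_connection[OF Y Z z] fd_conformal_connection[OF X Z z] sym conformal_term_linear
    by (simp add: algebra_simps)
qed

lemma hol_sect_curv_conformal_connection:
  assumes X: "X \<in> hopf_fields \<alpha>" and z: "z \<noteq> 0" and "X z = x" "x \<noteq> 0" and PQK: "P + Q + K = 1"
  shows "hol_sect_curv g (conformal_connection P Q K) X z =
    - p z * (fd G z x \<bullet> x + fd G z (J x) \<bullet> J x
      + (K\<^sup>2 + Q\<^sup>2) * ((G z \<bullet> G z) * (x \<bullet> x) - (G z \<bullet> x)\<^sup>2 - (G z \<bullet> J x)\<^sup>2)) / (x \<bullet> x)"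
proof -
  have "hol_sect_curv g (conformal_connection P Q K) X z =
      ((- (x \<bullet> x) * (fd G z x \<bullet> x + fd G z (J x) \<bullet> J x
      + (K\<^sup>2 + Q\<^sup>2) * ((G z \<bullet> G z) * (x \<bullet> x) - (G z \<bullet> x)\<^sup>2 - (G z \<bullet> J x)\<^sup>2))) / p z) / ((x \<bullet> x) / p z)\<^sup>2"
    unfolding hol_sect_curv_def g_eq[OF z] \<open>X z = x\<close>
      curvature_conformal_connection[OF X hopf_fields_J[OF X] hopf_fields_J[OF X] z]
      conformal_term_curvature[OF PQK] ..
  also have "\<dots> = - p z * (fd G z x \<bullet> x + fd G z (J x) \<bullet> J x
      + (K\<^sup>2 + Q\<^sup>2) * ((G z \<bullet> G z) * (x \<bullet> x) - (G z \<bullet> x)\<^sup>2 - (G z \<bullet> J x)\<^sup>2)) / (x \<bullet> x)"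
  proof -
    have "((- n * e) / q) / (n / q)\<^sup>2 = - q * e / n" if "0 < n" "0 < q" for n e q :: real
      using that by (simp add: field_simps power2_eq_square)
    then show ?thesis using p_pos[OF z] \<open>x \<noteq> 0\<close> by simp
  qed
  finally show ?thesis .
qed

end

section \<open>Vector fields with symmetric derivative\<close>

lemma exists_complex_orthogonal:
  assumes "CARD('n) \<ge> 2"
  obtains x :: "complex^'n" where "x \<noteq> 0" "z \<bullet> x = 0" "z \<bullet> J x = 0"
proof -
  obtain i j :: 'n where ij: "i \<noteq> j" and zi: "z = 0 \<or> z $ i \<noteq> 0"
  proof (cases "z = 0")
    case True
    obtain S :: "'n set" where "card S = 2"
      using assms obtain_subset_with_card_n[of 2 "UNIV :: 'n set"] by auto
    then obtain i j where "i \<noteq> j" "S = {i, j}" by (meson card_2_iff)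
    then show ?thesis using that True by blast
  next
    case False
    then obtain i where i: "z $ i \<noteq> 0" by (auto simp: vec_eq_iff)
    have "card (UNIV :: 'n set) \<noteq> card {i}" using assms by simp
    then have "UNIV \<noteq> {i}" by metis
    then show ?thesis using that i by (metis UNIV_eq_I insertI1 singletonD empty_iff insert_iff)
  qed
  \<comment> \<open>In the coordinates \<open>i\<close>, \<open>j\<close> the vector (conj z_j, -
    conj z_i) is Hermitian orthogonal to \<open>z\<close>. The real and imaginary parts of the
    Hermitian product are the inner products with \<open>x\<close> and \<open>J x\<close>.\<close>
  define c d where "c = (if z = 0 then 1 else cnj (z $ j))" and "d = (if z = 0 then 1 else - cnj (z $ i))"
  define x where "x = c *s axis i 1 + d *s axis j (1::complex)"
  have "x $ j = d" using ij by (simp add: x_def axis_def)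
  then have "x \<noteq> 0" using zi by (auto simp: d_def split: if_splits)
  have s: "(\<Sum>k\<in>UNIV. z $ k * cnj (x $ k)) = z $ i * cnj c + z $ j * cnj d"
  proof -
    have "z $ k * cnj (x $ k) = (if k = i then z $ i * cnj c else 0) + (if k = j then z $ j * cnj d else 0)" for k
      using ij by (auto simp: x_def axis_def)
    then show ?thesis by (simp add: sum.distrib)
  qed
  have 0: "z $ i * cnj c + z $ j * cnj d = 0" by (simp add: c_def d_def)
  have "z \<bullet> x = Re (\<Sum>k\<in>UNIV. z $ k * cnj (x $ k))"
    by (simp add: inner_vec_def inner_complex_def)
  then have "z \<bullet> x = 0" using s 0 by simp
  have "z \<bullet> J x = Im (\<Sum>k\<in>UNIV. z $ k * cnj (x $ k))"
    by (simp add: inner_vec_def inner_complex_def J_def algebra_simps)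
  then have "z \<bullet> J x = 0" using s 0 by simp
  show thesis by (rule that) fact+
qed

lemma connected_punctured: "connected (- {0} :: (complex^'n) set)"
  by (rule connected_punctured_universe) simp

text \<open>A closed one-form written as a vector field. As no primitive is named, powers of
  \<open>p\<close> and \<open>ln p\<close> are treated alike; the instances below are a multiple of
  \<open>grad p\<close>, \<open>grad p\<close> itself, and its pluriharmonic part.\<close>

locale symmetric_field =
  fixes U :: "complex^'n \<Rightarrow> complex^'n"
  assumes smooth: "smooth_on (- {0}) U"
    and sym: "\<And>z u v. z \<noteq> 0 \<Longrightarrow> fd U z u \<bullet> v = fd U z v \<bullet> u"
    and dim: "CARD('n) \<ge> 2"
begin

text \<open>The third derivative of a local primitive. The two transpositions in
  \<open>T_swap\<close>, one from equality of mixed derivatives and one from closedness, make it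
  symmetric in all three vectors.\<close>

definition T :: "complex^'n \<Rightarrow> complex^'n \<Rightarrow> complex^'n \<Rightarrow> complex^'n \<Rightarrow> real" where
  "T z v x y = fd (\<lambda>w. fd U w x) z v \<bullet> y"

lemma linear_fd: "z \<noteq> 0 \<Longrightarrow> linear (fd U z)"
  by (rule bounded_linear.linear[OF smooth_on_linear_fd[OF smooth]]) simp

lemma has_derivative_T: "z \<noteq> 0 \<Longrightarrow> ((\<lambda>w. fd U w x \<bullet> y) has_derivative (\<lambda>v. T z v x y)) (at z)"
  unfolding T_def
  by (intro has_derivative_inner_left smooth_on_has_derivative[OF smooth_on_fd[OF smooth]]) simp

lemma T_unique:
  assumes "z \<noteq> 0" "(f has_derivative f') (at z)" "\<And>w. w \<noteq> 0 \<Longrightarrow> fd U w x \<bullet> y = f w"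
  shows "T z v x y = f' v"
proof -
  have "((\<lambda>w. fd U w x \<bullet> y) has_derivative f') (at z)"
    by (rule has_derivative_transform_within_open[OF assms(2), of "- {0}"]) (use assms(1,3) in auto)
  then show ?thesis using has_derivative_unique[OF has_derivative_T[OF assms(1)]] by metis
qed

lemma T_swap:
  assumes "z \<noteq> 0"
  shows "T z v x y = T z x v y" "T z v x y = T z v y x"
proof -
  show "T z v x y = T z x v y"
    unfolding T_def using assms second_derivative_symmetric[OF _ smooth, of z x v]
    by (simp add: open_Compl)
  show "T z v x y = T z v y x"
    by (rule T_unique[OF assms has_derivative_T[OF assms] sym])
qed

lemma T_linear: "z \<noteq> 0 \<Longrightarrow> linear (\<lambda>v. T z v x y)"
  using has_derivative_linear[OF has_derivative_T] .

lemma hermitian_part_polarize: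
  assumes herm: "\<And>x. fd U z x \<bullet> x + fd U z (J x) \<bullet> J x = l * (x \<bullet> x)" and z: "z \<noteq> 0"
  shows "fd U z x \<bullet> y + fd U z (J x) \<bullet> J y = l * (x \<bullet> y)"
  using herm[of "x + y"] herm[of x] herm[of y] sym[OF z, of x y] sym[OF z, of "J x" "J y"]
  by (simp add: J_simps linear_add[OF linear_fd[OF z]] inner_add_left inner_add_right inner_commute[of y x]
      algebra_simps)

text \<open>In complex notation: if \<open>u\<^bsub>i\<bar>j\<^esub> = l \<delta>\<^bsub>ij\<^esub>\<close>, the symmetry of \<open>u\<^bsub>i\<bar>jk\<^esub>\<close> in \<open>i, k\<close> gives
  \<open>l\<^bsub>k\<^esub> \<delta>\<^bsub>ij\<^esub> = l\<^bsub>i\<^esub> \<delta>\<^bsub>kj\<^esub>\<close>.\<close>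

lemma hermitian_part_constant:
  assumes herm: "\<And>z x. z \<noteq> 0 \<Longrightarrow> fd U z x \<bullet> x + fd U z (J x) \<bullet> J x = l z * (x \<bullet> x)"
  obtains c where "\<And>z. z \<noteq> 0 \<Longrightarrow> l z = c"
proof -
  note pol = hermitian_part_polarize[OF herm]
  \<comment> \<open>Evaluation at a fixed unit vector expresses \<open>l\<close> through the
    derivative of \<open>U\<close>, which shows that \<open>l\<close> is differentiable.\<close>
  obtain e :: "complex^'n" where e: "e \<in> Basis" using nonempty_Basis by blast
  define l' where "l' z v = T z v e e + T z v (J e) (J e)" for z v
  have l: "(l has_derivative l' z) (at z)" if z: "z \<noteq> 0" for z
  proof (rule has_derivative_transform_within_open[of _ _ _ _ "- {0}"])
    show "((\<lambda>w. fd U w e \<bullet> e + fd U w (J e) \<bullet> J e) has_derivative l' z) (at z)"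
      unfolding l'_def by (intro has_derivative_add has_derivative_T z)
    show "fd U w e \<bullet> e + fd U w (J e) \<bullet> J e = l w" if "w \<in> - {0}" for w
      using herm[of w e] that e by simp
  qed (use z in auto)
  have T_J: "T z v x y + T z v (J x) (J y) = l' z v * (x \<bullet> y)" if z: "z \<noteq> 0" for z v x y
  proof -
    have "((\<lambda>w. l w * (x \<bullet> y) - fd U w (J x) \<bullet> J y) has_derivative
        (\<lambda>v. l' z v * (x \<bullet> y) - T z v (J x) (J y))) (at z)"
      by (intro has_derivative_diff has_derivative_mult_left l has_derivative_T z)
    from T_unique[OF z this, of x y v] show ?thesis using pol[of _ x y] by (simp add: eq_diff_eq)
  qed
  have l'_0: "l' z v = 0" if z: "z \<noteq> 0" for z v
  proof -
    \<comment> \<open>With \<open>x\<close> complex orthogonal to \<open>v\<close>, differentiating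
      along \<open>x\<close> and along \<open>J x\<close> gives two relations with right side 0.
      Eliminating \<open>T z x (J v) (J x)\<close>, which occurs in both up to symmetry, leaves
      \<open>l' z v * (x \<bullet> x) = 0\<close>.\<close>
    obtain x where x: "x \<noteq> 0" "v \<bullet> x = 0" "v \<bullet> J x = 0" using exists_complex_orthogonal[OF dim] by metis
    have "T z x v x + T z x (J v) (J x) = 0" "T z (J x) v (J x) - T z (J x) (J v) x = 0"
      using T_J[OF z, of x v x] T_J[OF z, of "J x" v "J x"] x by (simp_all add: T_def)
    moreover have "T z x v x = T z v x x" "T z (J x) v (J x) = T z v (J x) (J x)"
      using T_swap[OF z] by metis+
    moreover have "T z x (J v) (J x) = T z (J x) (J v) x" using T_swap[OF z] by metis
    ultimately have "l' z v * (x \<bullet> x) = 0" using T_J[OF z, of v x x] by simp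
    then show ?thesis using x(1) by simp
  qed
  have der0: "(l has_derivative (\<lambda>v. 0)) (at z)" if "z \<in> - {0}" for z
    by (rule has_derivative_eq_rhs[OF l]) (use that l'_0 in auto)
  have "l z = l e" if "z \<noteq> 0" for z
    by (rule has_derivative_zero_unique_connected[OF _ connected_punctured der0])
      (use that e in \<open>simp_all add: open_Compl nonzero_Basis\<close>)
  then show thesis by (rule that)
qed

text \<open>If \<open>u\<close> is pluriharmonic then \<open>u\<^bsub>ij\<^esub>\<close> is holomorphic, hence constant on every complex line
  that misses the origin.\<close>

lemma derivative_constant:
  assumes anti: "\<And>z x y. z \<noteq> 0 \<Longrightarrow> fd U z x \<bullet> y + fd U z (J x) \<bullet> J y = 0"
    and bound: "\<And>z x. z \<noteq> 0 \<Longrightarrow> norm (fd U z x) \<le> C * norm x"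
    and "z \<noteq> 0" "z' \<noteq> 0"
  shows "fd U z x = fd U z' x"
proof -
  \<comment> \<open>The hypothesis \<open>anti\<close>, differentiated and combined with the
    symmetry of \<open>T\<close>, leaves only the types (3,0) and (0,3). These are the
    Cauchy-Riemann equations for \<open>h\<close> below.\<close>
  have T_J: "T z (J v) (J x) y = - T z v x y" if z: "z \<noteq> 0" for z v x y
  proof -
    have der: "((\<lambda>w. - (fd U w (J v) \<bullet> J x)) has_derivative (\<lambda>y. - T z y (J v) (J x))) (at z)"
      by (intro has_derivative_minus has_derivative_T z)
    have "fd U w v \<bullet> x = - (fd U w (J v) \<bullet> J x)" if "w \<noteq> 0" for w
      using anti[OF that, of v x] by linarith
    from T_unique[OF z der this] have "T z y v x = - T z y (J v) (J x)" .
    moreover have "T z y v x = T z v x y" "T z y (J v) (J x) = T z (J v) (J x) y"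
      using T_swap[OF z] by metis+
    ultimately show ?thesis by simp
  qed
  have T_J': "T z (J v) x y = T z v (J x) y" if z: "z \<noteq> 0" for z v x y
    using T_J[OF z, of v "J x" y] T_swap(1)[OF z, of "J v" "- x" y] T_swap(1)[OF z, of "J v" x y]
      linear_neg[OF T_linear[OF z, of "J v" y], of x] by simp
  have T_line: "T z v x y = 0"
    if z: "z \<noteq> 0" and miss: "\<And>\<zeta>. z + \<zeta> *s v \<noteq> 0" for z v x y
  proof -
    \<comment> \<open>The real second derivative made complex linear in \<open>x\<close>, hence up
      to a factor a derivative of type (2,0).\<close>
    define h where "h w = Complex (fd U w x \<bullet> y) (- (fd U w (J x) \<bullet> y))" for w
    define h' where "h' w u = Complex (T w u x y) (- T w u (J x) y)" for w u
    have h: "(h has_derivative h' w) (at w)" if "w \<noteq> 0" for w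
    proof -
      have "((\<lambda>w. of_real (fd U w x \<bullet> y) + \<i> * of_real (- (fd U w (J x) \<bullet> y))) has_derivative
        (\<lambda>u. of_real (T w u x y) + \<i> * of_real (- T w u (J x) y))) (at w)"
        by (intro has_derivative_add has_derivative_of_real has_derivative_mult_right has_derivative_minus
            has_derivative_T that)
      then show ?thesis by (simp add: h_def[abs_def] h'_def[abs_def] Complex_eq)
    qed
    have f: "((\<lambda>\<zeta>. h (z + \<zeta> *s v)) has_field_derivative h' (z + \<zeta> *s v) v) (at \<zeta>)" for \<zeta>
    proof -
      have "((\<lambda>\<zeta>. z + \<zeta> *s v) has_derivative (\<lambda>\<xi>. \<xi> *s v)) (at \<zeta>)"
      proof -
        have "bounded_linear (\<lambda>\<xi>. \<xi> *s v)"
          by (rule linear_conv_bounded_linear[THEN iffD1], rule linearI)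
            (simp_all add: vec_eq_iff algebra_simps)
        then show ?thesis by (auto intro!: derivative_eq_intros bounded_linear_imp_has_derivative)
      qed
      from diff_chain_at[OF this h[OF miss]]
      have "((\<lambda>\<zeta>. h (z + \<zeta> *s v)) has_derivative (\<lambda>\<xi>. h' (z + \<zeta> *s v) (\<xi> *s v))) (at \<zeta>)"
        by (simp add: o_def)
      moreover have "h' w (\<xi> *s v) = h' w v * \<xi>" if w: "w \<noteq> 0" for w \<xi>
      proof -
        have "\<xi> *s v = Re \<xi> *\<^sub>R v + Im \<xi> *\<^sub>R J v"
          by (simp add: vec_eq_iff J_def complex_eq_iff)
        then have "T w (\<xi> *s v) x y = Re \<xi> * T w v x y + Im \<xi> * T w (J v) x y" for x y
          by (simp add: linear_add[OF T_linear[OF w]] linear_scale[OF T_linear[OF w]])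
        then show ?thesis
          using T_J'[OF w, of v x y] T_J[OF w, of v x y] by (simp add: h'_def complex_eq_iff)
      qed
      ultimately show ?thesis using miss by (simp add: has_field_derivative_def)
    qed
    have "bounded (range (\<lambda>\<zeta>. h (z + \<zeta> *s v)))"
    proof (rule boundedI)
      fix c assume "c \<in> range (\<lambda>\<zeta>. h (z + \<zeta> *s v))"
      then obtain \<zeta> where c: "c = h (z + \<zeta> *s v)" by auto
      have b: "\<bar>fd U (z + \<zeta> *s v) u \<bullet> y\<bar> \<le> C * norm u * norm y" for u
        using Cauchy_Schwarz_ineq2[of "fd U (z + \<zeta> *s v) u" y] bound[OF miss, of \<zeta> u]
        by (meson mult_right_mono norm_ge_zero order_trans)
      have "norm c \<le> \<bar>fd U (z + \<zeta> *s v) x \<bullet> y\<bar> + \<bar>fd U (z + \<zeta> *s v) (J x) \<bullet> y\<bar>"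
        unfolding c h_def by (rule order_trans[OF cmod_le]) simp
      then show "norm c \<le> C * norm x * norm y + C * norm (J x) * norm y"
        using b[of x] b[of "J x"] by linarith
    qed
    moreover have "(\<lambda>\<zeta>. h (z + \<zeta> *s v)) holomorphic_on UNIV"
      using f by (auto simp: holomorphic_on_def field_differentiable_def)
    ultimately have "(\<lambda>\<zeta>. h (z + \<zeta> *s v)) constant_on UNIV" by (intro Liouville_theorem)
    then obtain c where "\<And>\<zeta>. h (z + \<zeta> *s v) = c" by (auto simp: constant_on_def)
    then have "((\<lambda>\<zeta>. c) has_field_derivative h' z v) (at 0)" using f[of 0] by simp
    then have "h' z v = 0" using DERIV_const DERIV_unique by blast
    then show ?thesis by (simp add: h'_def complex_eq_iff)
  qed
  have T_0: "T z v x y = 0" if z: "z \<noteq> 0" for z v x y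
  proof -
    \<comment> \<open>A line through \<open>z\<close> in direction \<open>v\<close> can meet the
      origin only if \<open>v\<close> is a complex multiple of \<open>z\<close>, and then it is
      orthogonal to \<open>e\<close> and \<open>J e\<close>. Such \<open>v\<close> is the difference
      of \<open>v + e\<close> and \<open>e\<close>, both of which give lines missing the
      origin.\<close>
    obtain e where e: "e \<noteq> 0" "z \<bullet> e = 0" "z \<bullet> J e = 0" using exists_complex_orthogonal[OF dim] by metis
    have off: "T z v x y = 0" if v: "v \<bullet> e \<noteq> 0 \<or> v \<bullet> J e \<noteq> 0" for v
    proof (rule T_line[OF z])
      fix \<zeta> show "z + \<zeta> *s v \<noteq> 0"
      proof
        assume 0: "z + \<zeta> *s v = 0"
        have "z + \<zeta> *s v = z + Re \<zeta> *\<^sub>R v + Im \<zeta> *\<^sub>R J v"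
          by (simp add: vec_eq_iff J_def complex_eq_iff)
        then have "(z + Re \<zeta> *\<^sub>R v + Im \<zeta> *\<^sub>R J v) \<bullet> e = 0" "(z + Re \<zeta> *\<^sub>R v + Im \<zeta> *\<^sub>R J v) \<bullet> J e = 0"
          using 0 by simp_all
        then have "Re \<zeta> * (v \<bullet> e) - Im \<zeta> * (v \<bullet> J e) = 0" "Re \<zeta> * (v \<bullet> J e) + Im \<zeta> * (v \<bullet> e) = 0"
          using e by (simp_all add: inner_add_left inner_J_left)
        then have "((Re \<zeta>)\<^sup>2 + (Im \<zeta>)\<^sup>2) * ((v \<bullet> e)\<^sup>2 + (v \<bullet> J e)\<^sup>2) = 0" by algebra
        then have "\<zeta> = 0" using v by (auto simp: sum_power2_eq_zero_iff complex_eq_iff)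
        then show False using 0 z by simp
      qed
    qed
    show ?thesis
    proof (cases "v \<bullet> e \<noteq> 0 \<or> v \<bullet> J e \<noteq> 0")
      case False
      have "T z (v + e) x y = 0" "T z e x y = 0" using off e(1) False by (simp_all add: inner_add_left)
      then show ?thesis by (simp add: linear_add[OF T_linear[OF z]])
    qed (rule off)
  qed
  have "fd U z x \<bullet> y = fd U z' x \<bullet> y" for y
    by (rule has_derivative_zero_unique_connected[of "- {0}" "\<lambda>z. fd U z x \<bullet> y"])
      (use has_derivative_T T_0 assms(3,4) connected_punctured in auto)
  then show ?thesis using vector_eq_rdot by blast
qed

end

section \<open>Potentials of metrics with constant holomorphic sectional curvature\<close>

lemma second_derivative_at_min:
  fixes \<phi> \<phi>' :: "real \<Rightarrow> real"
  assumes d: "0 < d" and der: "\<And>s. \<bar>s\<bar> < d \<Longrightarrow> (\<phi> has_real_derivative \<phi>' s) (at s)"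
    and der2: "(\<phi>' has_real_derivative D) (at 0)" and min: "\<And>s. \<bar>s\<bar> < d \<Longrightarrow> \<phi> 0 \<le> \<phi> s"
  shows "\<phi>' 0 = 0" "0 \<le> D"
proof -
  show 0: "\<phi>' 0 = 0"
    by (rule DERIV_local_min[OF der[of 0] d]) (use d min in auto)
  show "0 \<le> D"
  proof (rule ccontr)
    assume "\<not> 0 \<le> D"
    then obtain e where e: "0 < e" "\<And>h. 0 < h \<Longrightarrow> h < e \<Longrightarrow> \<phi>' (0 + h) < \<phi>' 0"
      using DERIV_neg_dec_right[OF der2] by auto
    define h where "h = min e d / 2"
    have h: "0 < h" "h < e" "h < d" using e(1) d by (auto simp: h_def min_def)
    have "\<exists>s. 0 < s \<and> s < h \<and> \<phi> h - \<phi> 0 = (h - 0) * \<phi>' s"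
      by (rule MVT2[OF h(1)]) (use der h in auto)
    then obtain s where s: "0 < s" "s < h" "\<phi> h - \<phi> 0 = h * \<phi>' s" by auto
    have "\<phi>' s < 0" using e(2)[of s] s h 0 by simp
    then have "\<phi> h < \<phi> 0" using s(3) h(1) by (metis diff_less_0_iff_less mult_pos_neg)
    then show False using min[of h] h by simp
  qed
qed

context hopf_conformal
begin

abbreviation V :: "complex^'n \<Rightarrow> complex^'n" where "V \<equiv> grad p"

lemma V_has_derivative: "z \<noteq> 0 \<Longrightarrow> (V has_derivative fd V z) (at z)"
  by (rule smooth_on_has_derivative[OF smooth_grad]) simp

lemma p_has_derivative: "z \<noteq> 0 \<Longrightarrow> (p has_derivative (\<lambda>v. V z \<bullet> v)) (at z)"
  using smooth_on_has_derivative[OF p_smooth, of z] inner_grad[OF p_smooth, of z]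
  by (simp add: has_derivative_eq_rhs)

lemma fd_V_symmetric: "z \<noteq> 0 \<Longrightarrow> fd V z u \<bullet> v = fd V z v \<bullet> u"
  by (rule fd_grad_symmetric[OF _ p_smooth]) (auto simp: open_Compl)

lemma fd_V_hopf: "z \<noteq> 0 \<Longrightarrow> fd V (hopf_map \<alpha> z) (hopf_map \<alpha> v) = hopf_map \<alpha> (fd V z v)"
  by (rule fd_equivariant[OF smooth_grad bounded_linear_hopf_map grad_hopf])

text \<open>Four times the Levi form of \<open>p\<close>; for \<open>p\<close> = |z|^2 it is 4
  |x|^2.\<close>

definition complex_hessian :: "complex^'n \<Rightarrow> complex^'n \<Rightarrow> real" where
  "complex_hessian z x = fd V z x \<bullet> x + fd V z (J x) \<bullet> J x"

text \<open>The last term does not depend on the direction, so constancy at a point is a condition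
  on the Hermitian form in the numerator. Of the coefficient 1 - \<kappa>/2, the 1 comes from
  differentiating 1/p in \<open>G\<close> and the rest from the square of \<open>G\<close>.\<close>

lemma hol_sect_curv_eq:
  assumes X: "X \<in> hopf_fields \<alpha>" and z: "z \<noteq> 0" and x: "X z = x" "x \<noteq> 0" and PQK: "P + Q + K = 1"
    and \<kappa>: "\<kappa> = K\<^sup>2 + Q\<^sup>2"
  shows "hol_sect_curv g (conformal_connection P Q K) X z =
    (complex_hessian z x - (1 - \<kappa> / 2) / p z * ((V z \<bullet> x)\<^sup>2 + (V z \<bullet> J x)\<^sup>2)) / (2 * (x \<bullet> x))
      - \<kappa> * (V z \<bullet> V z) / (4 * p z)"
proof -
  have pz: "0 < p z" using p_pos[OF z] .
  have "((\<lambda>w. - inverse (2 * p w)) has_derivative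
      (\<lambda>v. - (- (inverse (2 * p z) * (2 * (V z \<bullet> v)) * inverse (2 * p z))))) (at z)"
    using pz by (intro has_derivative_minus Deriv.has_derivative_inverse has_derivative_mult_right
        p_has_derivative[OF z]) simp
  from fd_eqI[OF has_derivative_scaleR[OF this V_has_derivative[OF z]]]
  have fdG0: "fd G z v = (- inverse (2 * p z)) *\<^sub>R fd V z v
      + (- (- (inverse (2 * p z) * (2 * (V z \<bullet> v)) * inverse (2 * p z)))) *\<^sub>R V z" for v
    unfolding G_def[abs_def] by simp
  have fdG: "fd G z v \<bullet> v = - (fd V z v \<bullet> v) / (2 * p z) + (V z \<bullet> v)\<^sup>2 / (2 * (p z)\<^sup>2)" for v
    unfolding fdG0 inner_add_left inner_scaleR_left using pz by (simp add: field_simps power2_eq_square)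
  have G: "G z \<bullet> v = - (V z \<bullet> v) / (2 * p z)" "G z \<bullet> G z = (V z \<bullet> V z) / (4 * (p z)\<^sup>2)" for v
    unfolding G_def inner_scaleR_left inner_scaleR_right using pz
    by (simp_all add: field_simps power2_eq_square)
  have arith: "- q * (- A / (2 * q) + b\<^sup>2 / (2 * q\<^sup>2) + (- B / (2 * q) + c\<^sup>2 / (2 * q\<^sup>2))
      + k * (w / (4 * q\<^sup>2) * n - (- b / (2 * q))\<^sup>2 - (- c / (2 * q))\<^sup>2)) / n
    = ((A + B) - (1 - k / 2) / q * (b\<^sup>2 + c\<^sup>2)) / (2 * n) - k * w / (4 * q)"
    if "0 < q" "0 < n" for q n A B b c k w :: real
    using that by (simp add: field_simps power2_eq_square)
  show ?thesis
    unfolding hol_sect_curv_conformal_connection[OF X z x PQK] fdG G(2) \<kappa>[symmetric] complex_hessian_def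
    unfolding G(1)
    by (rule arith[OF pz]) (simp add: x(2))
qed

text \<open>The quotient p / |z|^2 is invariant, so its minimum \<open>m\<close> over the compact
  annulus is global. There p - m |z|^2 has a minimum too: its gradient vanishes, and the Hessian of
  \<open>p\<close> is at least that of m |z|^2.\<close>

lemma exists_positive_point:
  obtains z where "z \<noteq> 0"
    "\<And>x. z \<bullet> x = 0 \<Longrightarrow> V z \<bullet> x = 0" "\<And>x. x \<noteq> 0 \<Longrightarrow> 0 < fd V z x \<bullet> x"
proof -
  define K where "K = cball (0::complex^'n) 1 - ball 0 a"
  have K: "z \<in> K \<longleftrightarrow> a \<le> norm z \<and> norm z \<le> 1" for z by (auto simp: K_def)
  have K0: "K \<subseteq> - {0}" using a_pos by (auto simp: K)
  have "compact K" unfolding K_def by (intro compact_diff) auto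
  obtain b :: "complex^'n" where "b \<in> Basis" using nonempty_Basis by blast
  then have "b \<in> K" using a_less_1 by (simp add: K)
  then have "K \<noteq> {}" by blast
  have "continuous_on K (\<lambda>z. p z / (z \<bullet> z))"
    using continuous_on_subset[OF smooth_on_continuous[OF p_smooth] K0] K0 by (intro continuous_intros) auto
  from continuous_attains_inf[OF \<open>compact K\<close> \<open>K \<noteq> {}\<close> this]
  obtain z0 where z0: "z0 \<in> K" "\<And>z. z \<in> K \<Longrightarrow> p z0 / (z0 \<bullet> z0) \<le> p z / (z \<bullet> z)" by blast
  define m where "m = p z0 / (z0 \<bullet> z0)"
  have "z0 \<noteq> 0" using z0(1) K0 by auto
  then have m: "0 < m" "p z0 = m * (z0 \<bullet> z0)" using p_pos by (auto simp: m_def)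
  have le: "m * (z \<bullet> z) \<le> p z" if "z \<noteq> 0" for z
  proof (rule hopf_invariant_induct[of "\<lambda>z. m * (z \<bullet> z) \<le> p z", OF _ _ that])
    fix z :: "complex^'n" assume "a \<le> norm z" "norm z \<le> 1"
    then have "z \<in> K" by (simp add: K)
    then have "m \<le> p z / (z \<bullet> z)" "z \<noteq> 0" using z0(2) K0 by (auto simp: m_def)
    then show "m * (z \<bullet> z) \<le> p z" by (simp add: le_divide_eq)
  next
    fix z :: "complex^'n" assume "z \<noteq> 0"
    then show "(m * (hopf_map \<alpha> z \<bullet> hopf_map \<alpha> z) \<le> p (hopf_map \<alpha> z)) = (m * (z \<bullet> z) \<le> p z)"
      using a_pos by (simp add: inner_hopf_map p_hopf)
  qed
  have crit: "V z0 \<bullet> x - 2 * m * (z0 \<bullet> x) = 0" "0 \<le> fd V z0 x \<bullet> x - 2 * m * (x \<bullet> x)" for x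
  proof -
    \<comment> \<open>For |s| < d the point \<open>z0 + s *\<^sub>R x\<close> cannot reach the
      origin, where nothing is known about \<open>p\<close>.\<close>
    define d where "d = norm z0 / (norm x + 1)"
    have pos: "0 < norm x + 1" by (smt (verit) norm_ge_zero)
    have d: "0 < d" using \<open>z0 \<noteq> 0\<close> pos by (simp add: d_def)
    have ne: "z0 + s *\<^sub>R x \<noteq> 0" if "\<bar>s\<bar> < d" for s
    proof
      assume "z0 + s *\<^sub>R x = 0"
      then have "norm z0 = \<bar>s\<bar> * norm x" by (metis add_eq_0_iff2 norm_minus_cancel norm_scaleR)
      also have "\<dots> \<le> \<bar>s\<bar> * (norm x + 1)" by (simp add: mult_left_mono)
      also have "\<dots> < d * (norm x + 1)" using that pos by simp
      also have "\<dots> = norm z0" using pos by (simp add: d_def)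
      finally show False by simp
    qed
    define \<phi> where "\<phi> s = p (z0 + s *\<^sub>R x) - m * ((z0 + s *\<^sub>R x) \<bullet> (z0 + s *\<^sub>R x))" for s
    define \<phi>' where "\<phi>' s = V (z0 + s *\<^sub>R x) \<bullet> x - 2 * m * ((z0 + s *\<^sub>R x) \<bullet> x)" for s
    have line: "((\<lambda>s. z0 + s *\<^sub>R x) has_derivative (\<lambda>h. h *\<^sub>R x)) (at s)" for s
      by (auto intro!: derivative_eq_intros)
    have "(\<phi> has_real_derivative \<phi>' s) (at s)" if s: "\<bar>s\<bar> < d" for s
    proof -
      have "((\<lambda>s. p (z0 + s *\<^sub>R x)) has_derivative (\<lambda>h. V (z0 + s *\<^sub>R x) \<bullet> (h *\<^sub>R x))) (at s)"
        using diff_chain_at[OF line p_has_derivative[OF ne[OF s]]] by (simp add: o_def)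
      then have "(\<phi> has_derivative (\<lambda>h. V (z0 + s *\<^sub>R x) \<bullet> (h *\<^sub>R x)
          - m * ((z0 + s *\<^sub>R x) \<bullet> (h *\<^sub>R x) + (h *\<^sub>R x) \<bullet> (z0 + s *\<^sub>R x)))) (at s)"
        unfolding \<phi>_def[abs_def]
        by (intro has_derivative_diff has_derivative_mult_right has_derivative_inner line)
      then show ?thesis
        unfolding has_field_derivative_def
        by (rule has_derivative_eq_rhs) (auto simp: \<phi>'_def inner_commute algebra_simps)
    qed
    moreover have "(\<phi>' has_real_derivative (fd V z0 x \<bullet> x - 2 * m * (x \<bullet> x))) (at 0)"
    proof -
      have lin: "linear (fd V z0)" using has_derivative_linear[OF V_has_derivative[OF \<open>z0 \<noteq> 0\<close>]] .
      have "(V has_derivative fd V z0) (at (z0 + 0 *\<^sub>R x))" using V_has_derivative[OF \<open>z0 \<noteq> 0\<close>] by simp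
      from diff_chain_at[OF line this]
      have "((\<lambda>s. V (z0 + s *\<^sub>R x)) has_derivative (\<lambda>h. fd V z0 (h *\<^sub>R x))) (at 0)" by (simp add: o_def)
      then have "(\<phi>' has_derivative (\<lambda>h. fd V z0 (h *\<^sub>R x) \<bullet> x - 2 * m * ((h *\<^sub>R x) \<bullet> x))) (at 0)"
        unfolding \<phi>'_def[abs_def]
        by (intro has_derivative_diff has_derivative_mult_right has_derivative_inner_left line)
      then show ?thesis
        unfolding has_field_derivative_def
        by (rule has_derivative_eq_rhs) (auto simp: linear_scale[OF lin] algebra_simps)
    qed
    moreover have "\<phi> 0 \<le> \<phi> s" if "\<bar>s\<bar> < d" for s
      using le[OF ne[OF that]] m(2) by (simp add: \<phi>_def)
    ultimately have "\<phi>' 0 = 0" "0 \<le> fd V z0 x \<bullet> x - 2 * m * (x \<bullet> x)"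
      using second_derivative_at_min[OF d] by blast+
    then show "V z0 \<bullet> x - 2 * m * (z0 \<bullet> x) = 0" "0 \<le> fd V z0 x \<bullet> x - 2 * m * (x \<bullet> x)"
      by (simp_all add: \<phi>'_def)
  qed
  show thesis
  proof (rule that[OF \<open>z0 \<noteq> 0\<close>])
    show "V z0 \<bullet> x = 0" if "z0 \<bullet> x = 0" for x using crit(1)[of x] that by simp
    show "0 < fd V z0 x \<bullet> x" if "x \<noteq> 0" for x
    proof -
      have "0 < 2 * m * (x \<bullet> x)" using m(1) that by simp
      then show ?thesis using crit(2)[of x] by linarith
    qed
  qed
qed

text \<open>The one-form \<open>p\<^sup>\<kappa>\<^sup>/\<^sup>2\<^sup>-\<^sup>1 dp\<close> is a multiple of \<open>d(p\<^sup>\<kappa>\<^sup>/\<^sup>2)\<close>, or of \<open>d(ln p)\<close> when \<open>\<kappa> = 0\<close>.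
  It is chosen because its complex Hessian absorbs the term quadratic in \<open>dp\<close>.\<close>

lemma constant_curvature_complex_hessian:
  assumes dim: "CARD('n) \<ge> 2"
    and const: "\<And>z x. z \<noteq> 0 \<Longrightarrow>
      complex_hessian z x - (1 - \<kappa> / 2) / p z * ((V z \<bullet> x)\<^sup>2 + (V z \<bullet> J x)\<^sup>2) = c z * (x \<bullet> x)"
  shows "\<kappa> = 2" "\<exists>l>0. \<forall>z x. z \<noteq> 0 \<longrightarrow> complex_hessian z x = l * (x \<bullet> x)"
proof -
  define r where "r = \<kappa> / 2 - 1"
  define U where "U z = (p z powr r) *\<^sub>R V z" for z
  have smooth_U: "smooth_on (- {0}) U"
    unfolding U_def[abs_def]
    by (intro smooth_on_scaleR smooth_on_powr p_smooth smooth_grad) (auto simp: p_pos)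
  have fdU: "fd U z x = (p z powr r) *\<^sub>R (fd V z x + (r / p z * (V z \<bullet> x)) *\<^sub>R V z)" if z: "z \<noteq> 0" for z x
  proof -
    have pz: "0 < p z" using p_pos[OF z] .
    have "((\<lambda>y. y powr r) has_real_derivative r * p z powr (r - 1)) (at (p z))"
      using pz by (rule has_real_derivative_powr)
    then have "((\<lambda>y. y powr r) has_derivative (\<lambda>h. r * p z powr (r - 1) * h)) (at (p z))"
      by (simp add: has_field_derivative_def)
    from diff_chain_at[OF p_has_derivative[OF z] this]
    have "((\<lambda>w. p w powr r) has_derivative (\<lambda>v. r * p z powr (r - 1) * (V z \<bullet> v))) (at z)"
      by (simp add: o_def)
    from has_derivative_scaleR[OF this V_has_derivative[OF z]]
    have "fd U z = (\<lambda>v. (p z powr r) *\<^sub>R fd V z v + (r * p z powr (r - 1) * (V z \<bullet> v)) *\<^sub>R V z)"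
      unfolding U_def[abs_def] by (rule fd_eqI)
    moreover have "p z powr (r - 1) = p z powr r / p z" using pz by (simp add: powr_diff)
    ultimately show ?thesis by (simp add: scaleR_add_right mult_ac)
  qed
  interpret U: symmetric_field U
    by unfold_locales
      (auto simp: smooth_U dim fdU inner_add_left fd_V_symmetric mult_ac)
  have herm: "fd U z x \<bullet> x + fd U z (J x) \<bullet> J x = (p z powr r * c z) * (x \<bullet> x)" if z: "z \<noteq> 0" for z x
  proof -
    have "fd U z x \<bullet> x + fd U z (J x) \<bullet> J x =
        p z powr r * (complex_hessian z x - (1 - \<kappa> / 2) / p z * ((V z \<bullet> x)\<^sup>2 + (V z \<bullet> J x)\<^sup>2))"
      unfolding fdU[OF z] complex_hessian_def r_def
      by (simp add: inner_add_left algebra_simps power2_eq_square diff_divide_distrib)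
    then show ?thesis unfolding const[OF z] by simp
  qed
  obtain l where l: "\<And>z. z \<noteq> 0 \<Longrightarrow> p z powr r * c z = l" using U.hermitian_part_constant[OF herm] by metis
  have "0 < l"
  proof -
    obtain z where z: "z \<noteq> 0" "\<And>x. z \<bullet> x = 0 \<Longrightarrow> V z \<bullet> x = 0" "\<And>x. x \<noteq> 0 \<Longrightarrow> 0 < fd V z x \<bullet> x"
      by (rule exists_positive_point) blast
    \<comment> \<open>At this point the differential of \<open>p\<close> vanishes on
      \<open>x\<close> and \<open>J x\<close>, so the sign of \<open>c z\<close> is that of the
      complex Hessian, whatever the sign of 1 - \<kappa>/2.\<close>
    obtain x where x: "x \<noteq> 0" "z \<bullet> x = 0" "z \<bullet> J x = 0" using exists_complex_orthogonal[OF dim] by metis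
    have "0 < complex_hessian z x" using z(3)[OF x(1)] z(3)[of "J x"] x(1) by (simp add: complex_hessian_def)
    then have "0 < c z * (x \<bullet> x)" using const[OF z(1), of x] z(2)[OF x(2)] z(2)[OF x(3)] by simp
    then have "0 < c z" using x(1) by (metis inner_gt_zero_iff zero_less_mult_pos2)
    then show ?thesis using l[OF z(1)] p_pos[OF z(1)] by auto
  qed
  show \<kappa>: "\<kappa> = 2"
  proof -
    obtain z :: "complex^'n" where z: "z \<in> Basis" using nonempty_Basis by blast
    then have z0: "z \<noteq> 0" by (auto simp: nonzero_Basis)
    have pz: "0 < p z" using p_pos[OF z0] .
    \<comment> \<open>Under the deck map the Euclidean square scales by \<open>a\<^sup>2\<close>,
      the complex Hessian form belonging to \<open>U\<close> by an additional
      \<open>(a\<^sup>2) powr r\<close>. Both are proportional with the same nonzero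
      \<open>l\<close> at both points, so that additional factor is 1.\<close>
    have "U (hopf_map \<alpha> w) = ((a\<^sup>2) powr r) *\<^sub>R hopf_map \<alpha> (U w)" if "w \<noteq> 0" for w
      using that a_pos p_pos[OF that] by (simp add: U_def p_hopf grad_hopf powr_mult hopf_map_simps)
    moreover have "bounded_linear (\<lambda>v. ((a\<^sup>2) powr r) *\<^sub>R hopf_map \<alpha> v)"
      by (intro bounded_linear_intros bounded_linear_hopf_map)
    ultimately have "fd U (hopf_map \<alpha> z) (hopf_map \<alpha> v) = ((a\<^sup>2) powr r) *\<^sub>R hopf_map \<alpha> (fd U z v)" for v
      using fd_equivariant[OF smooth_U, of "\<lambda>v. ((a\<^sup>2) powr r) *\<^sub>R hopf_map \<alpha> v"] z0 by blast
    then have "fd U (hopf_map \<alpha> z) (hopf_map \<alpha> z) \<bullet> hopf_map \<alpha> z + fd U (hopf_map \<alpha> z) (J (hopf_map \<alpha> z)) \<bullet> J (hopf_map \<alpha> z)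
        = (a\<^sup>2) powr r * a\<^sup>2 * (fd U z z \<bullet> z + fd U z (J z) \<bullet> J z)"
      by (simp only: J_hopf_map inner_scaleR_left inner_hopf_map) (simp add: algebra_simps)
    then have "l * (a\<^sup>2 * (z \<bullet> z)) = (a\<^sup>2) powr r * a\<^sup>2 * (l * (z \<bullet> z))"
      using z0 by (simp only: herm l inner_hopf_map hopf_map_eq_0_iff not_False_eq_True)
    then have "(a\<^sup>2) powr r = 1" using \<open>0 < l\<close> a_pos z0 by simp
    moreover have "0 < a\<^sup>2" "a\<^sup>2 < 1" using a_pos a_less_1 by (simp_all add: power_less_one_iff)
    ultimately have "r = 0" by (simp add: powr_eq_one_iff_gen)
    then show ?thesis by (simp add: r_def)
  qed
  have "complex_hessian z x = l * (x \<bullet> x)" if "z \<noteq> 0" for z x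
    using const[OF that, of x] l[OF that] p_pos[OF that] by (simp add: \<kappa> r_def)
  then show "\<exists>l>0. \<forall>z x. z \<noteq> 0 \<longrightarrow> complex_hessian z x = l * (x \<bullet> x)" using \<open>0 < l\<close> by blast
qed

section \<open>From a constant complex Hessian to a quadratic potential\<close>

text \<open>The second derivative of \<open>p\<close> commutes with the deck map, which is
  \<open>a\<close> times an isometry. Its norm is therefore invariant, and a bound on the annulus is
  a global one; this supplies the boundedness for Liouville's theorem.\<close>

lemma fd_V_bounded: obtains C where "\<And>z x. z \<noteq> 0 \<Longrightarrow> norm (fd V z x) \<le> C * norm x"
proof -
  define K where "K = cball (0::complex^'n) 1 - ball 0 a"
  have K: "z \<in> K \<longleftrightarrow> a \<le> norm z \<and> norm z \<le> 1" for z by (auto simp: K_def)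
  have K0: "K \<subseteq> - {0}" using a_pos by (auto simp: K)
  have "compact K" unfolding K_def by (intro compact_diff) auto
  moreover have "continuous_on K (\<lambda>z. \<Sum>b\<in>Basis. norm (fd V z b))"
    using continuous_on_subset[OF smooth_on_continuous[OF smooth_on_fd[OF smooth_grad]] K0]
    by (intro continuous_intros)
  ultimately have "bounded ((\<lambda>z. \<Sum>b\<in>Basis. norm (fd V z b)) ` K)"
    by (intro compact_imp_bounded compact_continuous_image)
  then obtain C where "\<forall>y \<in> (\<lambda>z. \<Sum>b\<in>Basis. norm (fd V z b)) ` K. norm y \<le> C"
    unfolding bounded_iff by blast
  then have C: "(\<Sum>b\<in>Basis. norm (fd V z b)) \<le> C" if "z \<in> K" for z
    using that abs_ge_self order_trans by (metis (no_types, lifting) image_eqI real_norm_def)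
  have "\<forall>x. norm (fd V z x) \<le> C * norm x" if "z \<noteq> 0" for z
  proof (rule hopf_invariant_induct[of "\<lambda>z. \<forall>x. norm (fd V z x) \<le> C * norm x", OF _ _ that])
    fix z :: "complex^'n" assume "a \<le> norm z" "norm z \<le> 1"
    then have z: "z \<in> K" by (simp add: K)
    show "\<forall>x. norm (fd V z x) \<le> C * norm x"
    proof
      fix x
      have "fd V z x = (\<Sum>b\<in>Basis. (x \<bullet> b) *\<^sub>R fd V z b)"
        using z K0 by (intro linear_eq_sum_Basis smooth_on_linear_fd[OF smooth_grad]) auto
      also have "norm \<dots> \<le> (\<Sum>b\<in>Basis. norm x * norm (fd V z b))"
        by (rule sum_norm_le) (simp add: Basis_le_norm mult_right_mono)
      also have "\<dots> \<le> norm x * C"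
        unfolding sum_distrib_left[symmetric] by (rule mult_left_mono[OF C[OF z]]) simp
      finally show "norm (fd V z x) \<le> C * norm x" by (simp add: mult.commute)
    qed
  next
    fix z :: "complex^'n" assume z: "z \<noteq> 0"
    have "(\<forall>x. norm (fd V (hopf_map \<alpha> z) x) \<le> C * norm x) \<longleftrightarrow>
      (\<forall>x. norm (fd V (hopf_map \<alpha> z) (hopf_map \<alpha> x)) \<le> C * norm (hopf_map \<alpha> x))"
      by (metis hopf_map_surj)
    also have "\<dots> \<longleftrightarrow> (\<forall>x. norm (fd V z x) \<le> C * norm x)"
      using a_pos by (simp add: fd_V_hopf[OF z] norm_hopf_map mult.left_commute)
    finally show "(\<forall>x. norm (fd V (hopf_map \<alpha> z) x) \<le> C * norm x) \<longleftrightarrow> (\<forall>x. norm (fd V z x) \<le> C * norm x)" .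
  qed
  then show thesis using that by blast
qed

lemma potential_quadratic:
  assumes dim: "CARD('n) \<ge> 2" and hess: "\<And>z x. z \<noteq> 0 \<Longrightarrow> complex_hessian z x = l * (x \<bullet> x)"
  obtains B where "linear B" "\<And>x y. B x \<bullet> y = B y \<bullet> x" "\<And>x. B (hopf_map \<alpha> x) = hopf_map \<alpha> (B x)"
    "\<And>x y. B x \<bullet> y + B (J x) \<bullet> J y = l * (x \<bullet> y)" "\<And>z. z \<noteq> 0 \<Longrightarrow> p z = (B z \<bullet> z) / 2"
proof -
  interpret V: symmetric_field V
    by unfold_locales (use smooth_grad fd_V_symmetric dim in auto)
  have pol: "fd V z x \<bullet> y + fd V z (J x) \<bullet> J y = l * (x \<bullet> y)" if "z \<noteq> 0" for z x y
    by (rule V.hermitian_part_polarize) (use hess[OF that] that in \<open>auto simp: complex_hessian_def\<close>)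
  \<comment> \<open>The gradient of the pluriharmonic function p - (l/4) |z|^2.\<close>
  define W where "W z = V z - (l / 2) *\<^sub>R z" for z
  have smooth_W: "smooth_on (- {0}) W"
    unfolding W_def[abs_def]
    by (intro smooth_on_diff smooth_on_scaleR smooth_on_const smooth_on_id smooth_grad) auto
  have fdW: "fd W z x = fd V z x - (l / 2) *\<^sub>R x" if "z \<noteq> 0" for z x
  proof -
    have "fd W z = (\<lambda>x. fd V z x - (l / 2) *\<^sub>R x)"
      unfolding W_def[abs_def]
      by (intro fd_eqI has_derivative_diff V_has_derivative[OF that] has_derivative_scaleR_right has_derivative_ident)
    then show ?thesis by simp
  qed
  interpret W: symmetric_field W
  proof unfold_locales
    show "fd W z u \<bullet> v = fd W z v \<bullet> u" if "z \<noteq> 0" for z u v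
      using fd_V_symmetric[OF that, of u v] by (simp add: fdW[OF that] inner_diff_left inner_commute[of u v])
  qed (rule smooth_W dim)+
  obtain C where C: "\<And>z x. z \<noteq> 0 \<Longrightarrow> norm (fd V z x) \<le> C * norm x" using fd_V_bounded by metis
  have W_const: "fd W z x = fd W z' x" if "z \<noteq> 0" "z' \<noteq> 0" for z z' x
  proof (rule W.derivative_constant[OF _ _ that])
    show "fd W z x \<bullet> y + fd W z (J x) \<bullet> J y = 0" if "z \<noteq> 0" for z x y
      using pol[OF that, of x y] by (simp add: fdW[OF that] inner_diff_left)
    show "norm (fd W z x) \<le> (C + \<bar>l / 2\<bar>) * norm x" if "z \<noteq> 0" for z x
      using norm_triangle_ineq4[of "fd V z x" "(l / 2) *\<^sub>R x"] C[OF that, of x]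
      unfolding fdW[OF that] by (simp add: distrib_right)
  qed
  obtain e :: "complex^'n" where "e \<in> Basis" using nonempty_Basis by blast
  then have e: "e \<noteq> 0" by (auto simp: nonzero_Basis)
  define B where "B = fd V e"
  have fdV: "fd V z = B" if "z \<noteq> 0" for z
    using W_const[OF that e] fdW[OF that] fdW[OF e] unfolding B_def by auto
  have B_lin: "bounded_linear B"
    unfolding B_def using smooth_on_linear_fd[OF smooth_grad, of e] e by simp
  have B_sym: "B x \<bullet> y = B y \<bullet> x" for x y unfolding B_def by (rule fd_V_symmetric[OF e])
  have B_hopf: "B (hopf_map \<alpha> x) = hopf_map \<alpha> (B x)" for x
    using fd_V_hopf[OF e, of x] fdV[OF e] fdV[of "hopf_map \<alpha> e"] e by simp
  have dB: "(B has_derivative B) (at z)" for z by (rule bounded_linear_imp_has_derivative[OF B_lin])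
  \<comment> \<open>\<open>V - B\<close> is constant, and the constant is fixed by the deck map, a
    strict contraction, hence zero. The same argument with factor \<open>a\<^sup>2\<close> removes
    the constant of integration of \<open>p\<close>.\<close>
  have V_B: "V z = B z" if z: "z \<noteq> 0" for z
  proof -
    define b where "b = V z - B z"
    have "((\<lambda>z. V z - B z) has_derivative (\<lambda>x. 0)) (at w)" if "w \<in> - {0}" for w
      using has_derivative_diff[OF V_has_derivative dB, of w] fdV[of w] that by simp
    from has_derivative_zero_unique_connected[OF _ connected_punctured this, of "hopf_map \<alpha> z" z]
    have "V (hopf_map \<alpha> z) - B (hopf_map \<alpha> z) = b" using z by (auto simp: b_def open_Compl)
    then have "hopf_map \<alpha> b = b" by (simp add: grad_hopf[OF z] B_hopf b_def hopf_map_simps)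
    then have "a * norm b = norm b" using norm_hopf_map[of b] by simp
    then have "b = 0" using a_less_1 by simp
    then show ?thesis by (simp add: b_def)
  qed
  have p_B: "p z = (B z \<bullet> z) / 2" if z: "z \<noteq> 0" for z
  proof -
    define b where "b = p z - (B z \<bullet> z) / 2"
    have "((\<lambda>z. p z - (B z \<bullet> z) / 2) has_derivative (\<lambda>x. 0)) (at w)" if "w \<in> - {0}" for w
    proof (rule has_derivative_eq_rhs)
      have "((\<lambda>z. p z - 1 / 2 * (B z \<bullet> z)) has_derivative (\<lambda>x. V w \<bullet> x - 1 / 2 * (B w \<bullet> x + B x \<bullet> w))) (at w)"
        using that by (intro has_derivative_diff has_derivative_mult_right p_has_derivative has_derivative_inner dB
            has_derivative_ident) auto
      then show "((\<lambda>z. p z - (B z \<bullet> z) / 2) has_derivative (\<lambda>x. V w \<bullet> x - 1 / 2 * (B w \<bullet> x + B x \<bullet> w))) (at w)"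
        by simp
      show "(\<lambda>x. V w \<bullet> x - 1 / 2 * (B w \<bullet> x + B x \<bullet> w)) = (\<lambda>x. 0)"
        using that V_B[of w] B_sym[of w] by auto
    qed
    from has_derivative_zero_unique_connected[OF _ connected_punctured this, of "hopf_map \<alpha> z" z]
    have "p (hopf_map \<alpha> z) - (B (hopf_map \<alpha> z) \<bullet> hopf_map \<alpha> z) / 2 = b" using z by (auto simp: b_def open_Compl)
    then have "a\<^sup>2 * b = b" by (simp add: p_hopf[OF z] B_hopf inner_hopf_map b_def right_diff_distrib)
    moreover have "a\<^sup>2 \<noteq> 1" using a_pos a_less_1 by (metis less_irrefl power_less_one_iff less_imp_le pos2)
    ultimately have "b = 0" by simp
    then show ?thesis by (simp add: b_def)
  qed
  show thesis
    by (rule that[OF bounded_linear.linear[OF B_lin] B_sym B_hopf _ p_B]) (use pol[OF e] in \<open>auto simp: B_def\<close>)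
qed

end

section \<open>Antilinear maps and complex symmetric matrices\<close>

text \<open>The antilinear map that represents the form Re(z^t A z) by the real inner product; for
  symmetric \<open>A\<close> the real gradient of that form is twice this map.\<close>

definition conj_mat :: "complex^'n^'n \<Rightarrow> complex^'n \<Rightarrow> complex^'n" where
  "conj_mat A x = (\<chi> i. cnj ((A *v x) $ i))"

lemma linear_conj_mat: "linear (conj_mat A)"
  by (rule linearI)
    (simp_all add: conj_mat_def vec_eq_iff matrix_vector_mult_def distrib_left sum.distrib scaleR_sum_right)

lemma conj_mat_J: "conj_mat A (J x) = - J (conj_mat A x)"
  by (simp add: conj_mat_def J_def vec_eq_iff vector_scalar_commute)

lemma inner_conj_mat: "conj_mat A x \<bullet> y = Re (\<Sum>i\<in>UNIV. y $ i * (A *v x) $ i)"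
  by (simp add: conj_mat_def inner_vec_def inner_complex_def algebra_simps)

lemma inner_conj_mat_symmetric:
  assumes "transpose A = A"
  shows "conj_mat A x \<bullet> y = conj_mat A y \<bullet> x"
proof -
  have A: "A $ i $ j = A $ j $ i" for i j using arg_cong[OF assms, of "\<lambda>M. M $ j $ i"] by (simp add: transpose_def)
  have "(\<Sum>i\<in>UNIV. y $ i * (A *v x) $ i) = (\<Sum>i\<in>UNIV. \<Sum>j\<in>UNIV. y $ i * (A $ i $ j * x $ j))"
    by (simp add: matrix_vector_mult_def sum_distrib_left)
  also have "\<dots> = (\<Sum>j\<in>UNIV. \<Sum>i\<in>UNIV. y $ i * (A $ i $ j * x $ j))" by (rule sum.swap)
  also have "\<dots> = (\<Sum>j\<in>UNIV. \<Sum>i\<in>UNIV. x $ j * (A $ j $ i * y $ i))"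
    by (intro sum.cong refl) (simp add: A[of _ j for j] mult_ac)
  also have "\<dots> = (\<Sum>j\<in>UNIV. x $ j * (A *v y) $ j)"
    by (simp add: matrix_vector_mult_def sum_distrib_left)
  finally show ?thesis by (simp add: inner_conj_mat)
qed

lemma Re_denominator:
  "Re (of_real ((norm z)\<^sup>2) + quad_form A z + cnj (quad_form A z)) = z \<bullet> z + 2 * (conj_mat A z \<bullet> z)"
  by (simp add: inner_conj_mat quad_form_def power2_norm_eq_inner)

lemma scalar_eq_J: "c *s x = Re c *\<^sub>R x + Im c *\<^sub>R J x"
  by (simp add: vec_eq_iff J_def complex_eq_iff)

lemma antilinear_eq_conj_mat:
  assumes L: "linear L" and L_J: "\<And>x. L (J x) = - J (L x)"
  shows "L x = conj_mat (\<chi> i j. cnj (L (axis j 1) $ i)) x"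
proof -
  have scalar: "L (c *s y) = cnj c *s L y" for c y
    by (simp add: scalar_eq_J linear_add[OF L] linear_scale[OF L] L_J)
  have "L x = L (\<Sum>j\<in>UNIV. x $ j *s axis j 1)" by (simp only: basis_expansion)
  also have "\<dots> = (\<Sum>j\<in>UNIV. cnj (x $ j) *s L (axis j 1))" by (simp add: linear_sum[OF L] scalar)
  finally show ?thesis
    by (simp add: conj_mat_def vec_eq_iff matrix_vector_mult_def mult.commute)
qed

text \<open>For a symmetric operator the quadratic form controls the norm: polarize between
  \<open>w\<close> and the vector \<open>z\<close> of the same length pointing along
  \<open>L w\<close>, and apply the parallelogram law.\<close>

lemma symmetric_quadratic_norm_bound:
  fixes L :: "'a::real_inner \<Rightarrow> 'a"
  assumes L: "linear L" and sym: "\<And>x y. L x \<bullet> y = L y \<bullet> x"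
    and bound: "\<And>z. z \<noteq> 0 \<Longrightarrow> 2 * \<bar>L z \<bullet> z\<bar> < z \<bullet> z" and w: "w \<noteq> 0"
  shows "4 * (L w \<bullet> L w) < w \<bullet> w"
proof (cases "L w = 0")
  case True
  then show ?thesis using w by simp
next
  case False
  define z where "z = (norm w / norm (L w)) *\<^sub>R L w"
  have "norm z = norm w" using False by (simp add: z_def)
  then have zz: "z \<bullet> z = w \<bullet> w" by (simp add: dot_square_norm)
  have Lwz: "L w \<bullet> z = norm w * norm (L w)"
    using False by (simp add: z_def dot_square_norm power2_eq_square)
  have weak: "2 * \<bar>L y \<bullet> y\<bar> \<le> y \<bullet> y" for y
    using bound[of y] by (cases "y = 0") (auto simp: linear_0[OF L])
  \<comment> \<open>\<open>bound\<close> is strict only at nonzero vectors, so one of these must be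
    nonzero for the sum of the two inequalities to be strict.\<close>
  have "w + z \<noteq> 0 \<or> w - z \<noteq> 0"
  proof (rule ccontr)
    assume "\<not> ?thesis"
    then have "w + w = 0" by (metis add_diff_cancel_left' diff_add_cancel right_minus_eq)
    then show False using w by (metis scaleR_2 scaleR_eq_0_iff zero_neq_numeral)
  qed
  then have "2 * (L (w + z) \<bullet> (w + z)) - 2 * (L (w - z) \<bullet> (w - z)) < (w + z) \<bullet> (w + z) + (w - z) \<bullet> (w - z)"
    using bound[of "w + z"] bound[of "w - z"] weak[of "w + z"] weak[of "w - z"] by (smt (verit))
  moreover have "L (w + z) \<bullet> (w + z) - L (w - z) \<bullet> (w - z) = 4 * (L w \<bullet> z)"
    using sym[of z w]
    by (simp add: linear_add[OF L] linear_diff[OF L] inner_add_left inner_add_right inner_diff_left inner_diff_right)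
  moreover have "(w + z) \<bullet> (w + z) + (w - z) \<bullet> (w - z) = 4 * (w \<bullet> w)"
    using zz by (simp add: inner_add_left inner_add_right inner_diff_left inner_diff_right)
  ultimately have "2 * (norm w * norm (L w)) < norm w * norm w"
    unfolding Lwz by (simp add: dot_square_norm power2_eq_square)
  then have "2 * norm (L w) < norm w" using w by (metis mult.left_commute mult_less_cancel_left_pos zero_less_norm_iff)
  then have "(2 * norm (L w))\<^sup>2 < (norm w)\<^sup>2" by (intro power_strict_mono) auto
  then show ?thesis by (simp add: power_mult_distrib dot_square_norm)
qed

text \<open>With \<open>u\<close> the conjugate of \<open>v\<close>, the value of A conj(A) on
  \<open>v\<close> is |L u|^2 for the real symmetric map \<open>L = conj_mat A\<close>. The claim
  becomes |L u| < |u| / 2.\<close>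

lemma pos_def_hermitian_quarter:
  fixes A :: "complex^'n^'n"
  assumes A: "transpose A = A" and pos: "\<And>z. z \<noteq> 0 \<Longrightarrow> 0 < z \<bullet> z + 2 * (conj_mat A z \<bullet> z)"
  shows "pos_def_hermitian (mat (1/4) - A ** matrix_cnj A)"
  unfolding pos_def_hermitian_def
proof (intro conjI allI impI)
  have sA: "A $ i $ j = A $ j $ i" for i j using arg_cong[OF A, of "\<lambda>M. M $ j $ i"] by (simp add: transpose_def)
  have "cnj (A $ j $ k) * A $ k $ i = A $ i $ k * cnj (A $ k $ j)" for i j k
    using sA[of k i] sA[of j k] by simp
  then show "transpose (matrix_cnj (mat (1/4) - A ** matrix_cnj A)) = mat (1/4) - A ** matrix_cnj A"
    by (simp add: vec_eq_iff transpose_def matrix_cnj_def matrix_matrix_mult_def mat_def mult.commute)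
  fix v :: "complex^'n" assume v: "v \<noteq> 0"
  define u where "u = (\<chi> i. cnj (v $ i))"
  have u: "u \<noteq> 0" "u \<bullet> u = v \<bullet> v"
    using v by (auto simp: u_def vec_eq_iff inner_vec_def inner_complex_def)
  have w: "matrix_cnj A *v v = conj_mat A u"
    by (simp add: vec_eq_iff conj_mat_def matrix_cnj_def matrix_vector_mult_def u_def)
  \<comment> \<open>Passing from \<open>z\<close> to \<open>J z\<close> changes the sign of the
    antilinear form and keeps |z|, so positivity bounds its absolute value.\<close>
  have bound: "2 * \<bar>conj_mat A z \<bullet> z\<bar> < z \<bullet> z" if "z \<noteq> 0" for z
    using pos[OF that] pos[of "J z"] that by (simp add: conj_mat_J)
  have "Re (\<Sum>i\<in>UNIV. cnj (v $ i) * ((mat (1/4) - A ** matrix_cnj A) *v v) $ i) =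
      Re (\<Sum>i\<in>UNIV. cnj (v $ i) * (v $ i / 4)) - Re (\<Sum>i\<in>UNIV. u $ i * (A *v (matrix_cnj A *v v)) $ i)"
  proof -
    have m: "(mat (1/4) *v v) $ i = v $ i / 4" for i
      by (simp add: matrix_vector_mult_def mat_def if_distrib[of "\<lambda>c. c * _"] cong: if_cong)
    show ?thesis
      by (simp add: m matrix_vector_mult_diff_rdistrib matrix_vector_mul_assoc u_def right_diff_distrib sum_subtractf)
  qed
  also have "Re (\<Sum>i\<in>UNIV. u $ i * (A *v (matrix_cnj A *v v)) $ i) = conj_mat A u \<bullet> conj_mat A u"
    unfolding w inner_conj_mat[symmetric] by (rule inner_conj_mat_symmetric[OF A])
  also have "Re (\<Sum>i\<in>UNIV. cnj (v $ i) * (v $ i / 4)) = (v \<bullet> v) / 4"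
    by (simp add: inner_vec_def inner_complex_def sum_divide_distrib add_divide_distrib)
  also have "(v \<bullet> v) / 4 - conj_mat A u \<bullet> conj_mat A u > 0"
    using symmetric_quadratic_norm_bound[OF linear_conj_mat inner_conj_mat_symmetric[OF A] bound u(1)] u(2) by simp
  finally show "0 < Re (\<Sum>i\<in>UNIV. cnj (v $ i) * ((mat (1/4) - A ** matrix_cnj A) *v v) $ i)" .
qed

lemma omega0_eq: "omega0 u v = 2 * (J u \<bullet> v)"
  unfolding omega0_def J_def inner_vec_def inner_complex_def
  by (simp add: sum_distrib_left sum_subtractf sum.distrib algebra_simps sum_negf)

section \<open>The two implications\<close>

context hopf_conformal
begin

lemma hopf_orbit_invariant:
  assumes f: "\<And>z. z \<noteq> 0 \<Longrightarrow> f (hopf_map \<alpha> z) = f z" and z0: "z0 \<noteq> 0" and z: "z \<in> hopf_orbit \<alpha> z0"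
  shows "z \<noteq> 0" "f z = f z0"
proof -
  define S where "S k = (\<chi> i. (\<alpha> $ i) powi k * z0 $ i)" for k
  have S0: "S k \<noteq> 0" for k using z0 by (auto simp: S_def vec_eq_iff)
  have SS: "S (k + 1) = hopf_map \<alpha> (S k)" for k
    by (simp add: S_def hopf_map_def vec_eq_iff power_int_add)
  have step: "f (S (k + 1)) = f (S k)" for k using f[OF S0] by (simp add: SS)
  have fS: "f (S k) = f z0" for k
  proof (induction k rule: int_induct[of _ 0])
    case base
    show ?case by (simp add: S_def)
  next
    case (step1 i)
    then show ?case using step by simp
  next
    case (step2 i)
    then show ?case using step[of "i - 1"] by simp
  qed
  obtain k where "z = S k" using z by (auto simp: hopf_orbit_def S_def)
  then show "z \<noteq> 0" "f z = f z0" using S0 fS by auto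
qed

lemma admissibleI:
  assumes dim: "CARD('n) \<ge> 2" and herm: "hermitian_metric \<alpha> g" and l: "0 < l"
    and hess: "\<And>z x. z \<noteq> 0 \<Longrightarrow> complex_hessian z x = l * (x \<bullet> x)"
  shows "admissible \<alpha> a g"
proof -
  obtain B where B: "linear B" and B_sym: "\<And>x y. B x \<bullet> y = B y \<bullet> x"
    and B_hopf: "\<And>x. B (hopf_map \<alpha> x) = hopf_map \<alpha> (B x)"
    and B_J: "\<And>x y. B x \<bullet> y + B (J x) \<bullet> J y = l * (x \<bullet> y)" and p_B: "\<And>z. z \<noteq> 0 \<Longrightarrow> p z = (B z \<bullet> z) / 2"
    using potential_quadratic[OF dim hess] by metis
  \<comment> \<open>The part of \<open>B\<close> commuting with \<open>J\<close> is l/2 times the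
    identity. Removing it and dividing by \<open>l\<close> leaves an antilinear map, which is given
    by a matrix.\<close>
  define L where "L x = (1 / l) *\<^sub>R B x - (1 / 2) *\<^sub>R x" for x
  have L: "linear L"
    by (rule linearI) (simp_all add: L_def linear_add[OF B] linear_scale[OF B] algebra_simps)
  have L_sym: "L x \<bullet> y = L y \<bullet> x" for x y
    using B_sym[of x y] by (simp add: L_def inner_diff_left inner_commute[of x y])
  have L_hopf: "L (hopf_map \<alpha> x) = hopf_map \<alpha> (L x)" for x
    by (simp add: L_def B_hopf hopf_map_simps)
  have L_J: "L (J x) = - J (L x)" for x
  proof -
    have "L (J x) \<bullet> y = - J (L x) \<bullet> y" for y
    proof -
      have "L x \<bullet> J y - L (J x) \<bullet> y = 0"
        using B_J[of x "J y"] l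
        by (simp add: L_def inner_diff_left inner_J_left field_simps)
      then show ?thesis by (simp add: inner_J_left)
    qed
    then show ?thesis using vector_eq_rdot by blast
  qed
  define A where "A = (\<chi> i j. cnj (L (axis j 1) $ i))"
  have L_A: "conj_mat A x = L x" for x unfolding A_def by (rule antilinear_eq_conj_mat[OF L L_J, symmetric])
  have symA: "transpose A = A"
  proof -
    have "L (axis j 1) $ i = L (axis i 1) $ j" for i j
    proof -
      have Re: "Re (x $ k) = x \<bullet> axis k 1" and Im: "Im (x $ k) = x \<bullet> J (axis k 1)" for x :: "complex^'n" and k
      proof -
        show "Re (x $ k) = x \<bullet> axis k 1" by (simp add: inner_axis inner_complex_def)
        have "J (axis k 1) = axis k \<i>" by (simp add: J_def axis_def vec_eq_iff)
        then show "Im (x $ k) = x \<bullet> J (axis k 1)" by (simp add: inner_axis inner_complex_def)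
      qed
      have "L x \<bullet> J y = L y \<bullet> J x" for x y
        using L_sym[of x "J y"] by (simp add: L_J inner_J_left)
      then show ?thesis using L_sym by (simp add: complex_eq_iff Re Im)
    qed
    then show ?thesis by (simp add: A_def transpose_def vec_eq_iff)
  qed
  have p_A: "p z = (l / 4) * (z \<bullet> z + 2 * (conj_mat A z \<bullet> z))" if "z \<noteq> 0" for z
    using p_B[OF that] l by (simp add: L_A L_def inner_diff_left field_simps)
  have "pos_def_hermitian (mat (1/4) - A ** matrix_cnj A)"
  proof (rule pos_def_hermitian_quarter[OF symA])
    show "0 < z \<bullet> z + 2 * (conj_mat A z \<bullet> z)" if "z \<noteq> 0" for z
      using p_pos[OF that] l unfolding p_A[OF that] by (simp add: zero_less_mult_iff)
  qed
  moreover have "diag_matrix \<alpha> ** A ** diag_matrix \<alpha> = a\<^sup>2 *\<^sub>R A"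
  proof -
    \<comment> \<open>\<open>L\<close> commutes with the deck map but is antilinear. Comparing
      entries on the axis vectors moves a multiplier across as a conjugate, and \<alpha>_i times its
      conjugate is \<open>a\<^sup>2\<close>.\<close>
    have entry: "\<alpha> $ i * A $ i $ j * \<alpha> $ j = a\<^sup>2 *\<^sub>R (A $ i $ j)" for i j
    proof -
      have "hopf_map \<alpha> (axis j 1) = \<alpha> $ j *s axis j 1" by (auto simp: hopf_map_def axis_def vec_eq_iff)
      then have "L (hopf_map \<alpha> (axis j 1)) = cnj (\<alpha> $ j) *s L (axis j 1)"
        by (simp add: scalar_eq_J linear_add[OF L] linear_scale[OF L] L_J)
      then have "cnj (\<alpha> $ j) * L (axis j 1) $ i = \<alpha> $ i * L (axis j 1) $ i"
        unfolding L_hopf by (auto simp: hopf_map_def vec_eq_iff)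
      then have "cnj (cnj (\<alpha> $ j) * L (axis j 1) $ i) = cnj (\<alpha> $ i * L (axis j 1) $ i)" by (rule arg_cong)
      then have "\<alpha> $ j * A $ i $ j = cnj (\<alpha> $ i) * A $ i $ j" by (simp add: A_def)
      then have "\<alpha> $ i * A $ i $ j * \<alpha> $ j = (\<alpha> $ i * cnj (\<alpha> $ i)) * A $ i $ j" by (simp add: mult_ac)
      also have "\<alpha> $ i * cnj (\<alpha> $ i) = of_real (a\<^sup>2)"
        by (simp only: complex_norm_square[symmetric] cmod_multiplier)
      finally show ?thesis by (simp add: scaleR_conv_of_real)
    qed
    have "(diag_matrix \<alpha> ** A ** diag_matrix \<alpha>) $ i $ j = \<alpha> $ i * A $ i $ j * \<alpha> $ j" for i j
      by (simp add: diag_matrix_def matrix_matrix_mult_def if_distrib[of "\<lambda>c. c * _"]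
          if_distrib[of "\<lambda>c. _ * c"] cong: if_cong)
    then show ?thesis by (simp only: vec_eq_iff entry vector_scaleR_component) simp
  qed
  \<comment> \<open>\<open>c0\<close> is 2/l: the factor l/4 of \<open>p_A\<close> contributes 4/l,
    and \<open>omega0\<close> is twice the Euclidean form.\<close>
  moreover have "kahler_form g z u v =
      (2 / l) / Re (of_real ((norm z)\<^sup>2) + quad_form A z + cnj (quad_form A z)) * omega0 u v"
    if "z \<noteq> 0" for z u v
    unfolding Re_denominator kahler_form_def g_eq[OF that] omega0_eq p_A[OF that] using l by simp
  ultimately show ?thesis
    unfolding admissible_def using herm symA l
    by (intro conjI exI[of _ "2 / l"] exI[of _ A]) auto
qed

text \<open>The antilinear part of the second derivative cancels between \<open>x\<close> and
  \<open>J x\<close>, so only the multiple of |z|^2 in the denominator contributes.\<close>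

lemma admissible_complex_hessian:
  assumes "admissible \<alpha> a g"
  obtains l where "\<And>z x. z \<noteq> 0 \<Longrightarrow> complex_hessian z x = l * (x \<bullet> x)"
proof -
  obtain c0 A where c0: "0 < c0" and symA: "transpose A = A"
    and K: "\<And>z u v. z \<noteq> 0 \<Longrightarrow> kahler_form g z u v =
      c0 / Re (of_real ((norm z)\<^sup>2) + quad_form A z + cnj (quad_form A z)) * omega0 u v"
    using assms unfolding admissible_def by blast
  define L where "L = conj_mat A"
  note sym = inner_conj_mat_symmetric[OF symA, folded L_def]
  have linL: "linear L" unfolding L_def by (rule linear_conj_mat)
  have p_L: "p z = 1 / (2 * c0) * (z \<bullet> z + 2 * (L z \<bullet> z))" if z: "z \<noteq> 0" for z
  proof -
    define R where "R = z \<bullet> z + 2 * (L z \<bullet> z)"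
    \<comment> \<open>Evaluating the two expressions for the form on \<open>z\<close> and
      \<open>J z\<close>, where \<open>omega0\<close> is 2 |z|^2, isolates
      \<open>p z\<close>.\<close>
    have "(z \<bullet> z) / p z = c0 / R * (2 * (z \<bullet> z))"
      using K[OF z, of z "J z"] unfolding Re_denominator kahler_form_def g_eq[OF z] omega0_eq
      by (simp add: R_def L_def)
    then have "(z \<bullet> z) * (1 / p z) = (z \<bullet> z) * (2 * c0 / R)" by (simp add: mult_ac)
    then have "1 / p z = 2 * c0 / R" using z by (simp only: mult_left_cancel inner_eq_zero_iff not_False_eq_True)
    moreover from this have "R \<noteq> 0" using p_pos[OF z] by auto
    ultimately have "p z = R / (2 * c0)" using p_pos[OF z] c0 by (simp add: field_simps)
    then show ?thesis by (simp add: R_def)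
  qed
  have dL: "(L has_derivative L) (at z)" for z
    by (rule bounded_linear_imp_has_derivative[OF linL[THEN linear_conv_bounded_linear[THEN iffD1]]])
  have V_L: "V z = (1 / c0) *\<^sub>R (z + 2 *\<^sub>R L z)" if z: "z \<noteq> 0" for z
  proof -
    have "((\<lambda>z. 1 / (2 * c0) * (z \<bullet> z + 2 * (L z \<bullet> z))) has_derivative
        (\<lambda>v. 1 / (2 * c0) * ((z \<bullet> v + v \<bullet> z) + 2 * (L z \<bullet> v + L v \<bullet> z)))) (at z)"
      by (intro has_derivative_mult_right has_derivative_add has_derivative_inner dL has_derivative_ident)
    then have "(p has_derivative (\<lambda>v. 1 / (2 * c0) * ((z \<bullet> v + v \<bullet> z) + 2 * (L z \<bullet> v + L v \<bullet> z)))) (at z)"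
      by (rule has_derivative_transform_within_open[of _ _ _ _ "- {0}"])
        (use z p_L in \<open>auto simp: open_Compl\<close>)
    from has_derivative_unique[OF p_has_derivative[OF z] this]
    have Vv: "V z \<bullet> v = 1 / (2 * c0) * ((z \<bullet> v + v \<bullet> z) + 2 * (L z \<bullet> v + L v \<bullet> z))" for v by metis
    have "V z \<bullet> v = ((1 / c0) *\<^sub>R (z + 2 *\<^sub>R L z)) \<bullet> v" for v
      unfolding Vv sym[of v z] inner_commute[of v z] using c0 by (simp add: inner_add_left field_simps)
    then show ?thesis using vector_eq_rdot by blast
  qed
  have fdV: "fd V z x = (1 / c0) *\<^sub>R (x + 2 *\<^sub>R L x)" if z: "z \<noteq> 0" for z x
  proof -
    have "((\<lambda>z. (1 / c0) *\<^sub>R (z + 2 *\<^sub>R L z)) has_derivative (\<lambda>x. (1 / c0) *\<^sub>R (x + 2 *\<^sub>R L x))) (at z)"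
      by (intro has_derivative_scaleR_right has_derivative_add dL has_derivative_ident)
    moreover have "fd V z = fd (\<lambda>z. (1 / c0) *\<^sub>R (z + 2 *\<^sub>R L z)) z"
      by (rule fd_cong[of "- {0}"]) (use z V_L in \<open>auto simp: open_Compl\<close>)
    ultimately show ?thesis by (simp add: fd_eqI)
  qed
  have "complex_hessian z x = (2 / c0) * (x \<bullet> x)" if "z \<noteq> 0" for z x
    unfolding complex_hessian_def fdV[OF that] L_def conj_mat_J
    by (simp add: inner_add_left algebra_simps add_divide_distrib)
  then show thesis by (rule that)
qed

lemma mem_hopf_orbit: "z \<in> hopf_orbit \<alpha> z"
  unfolding hopf_orbit_def by (rule range_eqI[of _ _ 0]) simp

lemma pointwise_constant_iff_admissible:
  assumes dim: "CARD('n) \<ge> 2" and herm: "hermitian_metric \<alpha> g"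
  shows "pointwise_constant_hsc \<alpha> g (canonical_connection \<alpha> g t s) \<longleftrightarrow>
    (1 - t + t * s)\<^sup>2 + s\<^sup>2 = 4 \<and> admissible \<alpha> a g"
proof -
  define P Q K where "P = (1 - s) * t" and "Q = (1 - s) * (1 - t) / 2" and "K = Q + s"
  define \<kappa> where "\<kappa> = K\<^sup>2 + Q\<^sup>2"
  have PQK: "P + Q + K = 1" by (simp add: P_def Q_def K_def field_simps)
  \<comment> \<open>This is 2 (K^2 + Q^2) = (K + Q)^2 + (K - Q)^2.\<close>
  have \<kappa>: "2 * \<kappa> = (1 - t + t * s)\<^sup>2 + s\<^sup>2"
    by (simp add: \<kappa>_def K_def Q_def field_simps power2_eq_square)
  have D: "canonical_connection \<alpha> g t s = conformal_connection P Q K"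
    unfolding canonical_connection_eq P_def Q_def K_def ..
  define H where "H z x = complex_hessian z x - (1 - \<kappa> / 2) / p z * ((V z \<bullet> x)\<^sup>2 + (V z \<bullet> J x)\<^sup>2)" for z x
  have hsc: "hol_sect_curv g (canonical_connection \<alpha> g t s) X z =
      H z (X z) / (2 * (X z \<bullet> X z)) - \<kappa> * (V z \<bullet> V z) / (4 * p z)"
    if "X \<in> hopf_fields \<alpha>" "z \<noteq> 0" "X z \<noteq> 0" for X z
    unfolding D H_def by (rule hol_sect_curv_eq[OF that(1,2) refl that(3) PQK \<kappa>_def])
  show ?thesis
  proof
    assume "pointwise_constant_hsc \<alpha> g (canonical_connection \<alpha> g t s)"
    then obtain c where c: "\<And>q z X. q \<in> hopf_manifold \<alpha> \<Longrightarrow> z \<in> q \<Longrightarrow> X \<in> hopf_fields \<alpha> \<Longrightarrow> X z \<noteq> 0 \<Longrightarrow>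
      hol_sect_curv g (canonical_connection \<alpha> g t s) X z = c q" unfolding pointwise_constant_hsc_def by blast
    have "H z x = (2 * (c (hopf_orbit \<alpha> z) + \<kappa> * (V z \<bullet> V z) / (4 * p z))) * (x \<bullet> x)" if z: "z \<noteq> 0" for z x
    proof (cases "x = 0")
      case True
      then show ?thesis
        by (simp add: H_def complex_hessian_def J_simps)
    next
      case False
      obtain X where X: "X \<in> hopf_fields \<alpha>" "X z = x" using hopf_field_with_value[OF z] by metis
      have "hopf_orbit \<alpha> z \<in> hopf_manifold \<alpha>" using z by (auto simp: hopf_manifold_def)
      from c[OF this mem_hopf_orbit X(1)] hsc[OF X(1) z] X(2) False
      have "H z x / (2 * (x \<bullet> x)) = c (hopf_orbit \<alpha> z) + \<kappa> * (V z \<bullet> V z) / (4 * p z)" by simp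
      then have "H z x = (c (hopf_orbit \<alpha> z) + \<kappa> * (V z \<bullet> V z) / (4 * p z)) * (2 * (x \<bullet> x))"
        using False by (metis divide_eq_eq inner_eq_zero_iff mult_eq_0_iff zero_neq_numeral)
      then show ?thesis by simp
    qed
    from constant_curvature_complex_hessian[OF dim this[unfolded H_def]]
    obtain l where "\<kappa> = 2" "0 < l" "\<And>z x. z \<noteq> 0 \<Longrightarrow> complex_hessian z x = l * (x \<bullet> x)" by blast
    then show "(1 - t + t * s)\<^sup>2 + s\<^sup>2 = 4 \<and> admissible \<alpha> a g"
      using admissibleI[OF dim herm] \<kappa> by auto
  next
    assume R: "(1 - t + t * s)\<^sup>2 + s\<^sup>2 = 4 \<and> admissible \<alpha> a g"
    then have \<kappa>2: "\<kappa> = 2" using \<kappa> by simp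
    obtain l where l: "\<And>z x. z \<noteq> 0 \<Longrightarrow> complex_hessian z x = l * (x \<bullet> x)"
      using admissible_complex_hessian R by metis
    \<comment> \<open>For \<kappa> = 2 the gradient term in \<open>H\<close> has coefficient 0, and
      this is the remaining curvature. It is invariant under the deck map, so any representative of
      an orbit gives its value.\<close>
    define f where "f z = l / 2 - (V z \<bullet> V z) / (2 * p z)" for z
    have f_hopf: "f (hopf_map \<alpha> z) = f z" if "z \<noteq> 0" for z
      using a_pos by (simp add: f_def grad_hopf[OF that] p_hopf[OF that] inner_hopf_map)
    have "hol_sect_curv g (canonical_connection \<alpha> g t s) X z = f z"
      if "X \<in> hopf_fields \<alpha>" "z \<noteq> 0" "X z \<noteq> 0" for X z
      using hsc[OF that] that(3) by (simp add: H_def \<kappa>2 l[OF that(2)] f_def)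
    moreover have "z \<noteq> 0 \<and> f z = f (SOME z. z \<in> q)" if q: "q \<in> hopf_manifold \<alpha>" and z: "z \<in> q" for q z
    proof -
      obtain z0 where z0: "z0 \<noteq> 0" "q = hopf_orbit \<alpha> z0" using q by (auto simp: hopf_manifold_def)
      have inv: "w \<noteq> 0 \<and> f w = f z0" if "w \<in> q" for w
        using hopf_orbit_invariant[where f = f and z = w, OF f_hopf z0(1)] that z0(2) by blast
      have "(SOME z. z \<in> q) \<in> q" using z by (rule someI)
      from inv[OF this] inv[OF z] show ?thesis by simp
    qed
    ultimately show "pointwise_constant_hsc \<alpha> g (canonical_connection \<alpha> g t s)"
      unfolding pointwise_constant_hsc_def by (intro exI[of _ "\<lambda>q. f (SOME z. z \<in> q)"]) metis
  qed
qed

end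

theorem proposition1p9:
  fixes \<alpha> :: "complex^'n" and a t s :: real and g :: "'n tensor2"
  assumes "CARD('n) \<ge> 2"
    and "isosceles \<alpha> a"
    and "hermitian_metric \<alpha> g"
    and "conformal_to_hopf \<alpha> g"
  shows "pointwise_constant_hsc \<alpha> g (canonical_connection \<alpha> g t s) \<longleftrightarrow>
           (1 - t + t * s)\<^sup>2 + s\<^sup>2 = 4 \<and> admissible \<alpha> a g"
proof -
  interpret isosceles_hopf \<alpha> a by unfold_locales fact
  obtain F where F: "F \<in> hopf_functions \<alpha>" and F_pos: "\<And>q. q \<in> hopf_manifold \<alpha> \<Longrightarrow> 0 < F q"
    and K: "\<And>z u v. z \<noteq> 0 \<Longrightarrow> kahler_form g z u v = F (hopf_orbit \<alpha> z) * omega_h z u v"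
    using assms(4) unfolding conformal_to_hopf_def by blast
  \<comment> \<open>The 2 comes from \<open>omega0_eq\<close>: the metric with form \<open>F\<close>
    times \<open>omega_h\<close> is 2 F / |z|^2 times the Euclidean one.\<close>
  define p where "p z = (z \<bullet> z) * inverse (2 * F (hopf_orbit \<alpha> z))" for z
  have Fz: "0 < F (hopf_orbit \<alpha> z)" if "z \<noteq> 0" for z
    using F_pos that by (auto simp: hopf_manifold_def)
  interpret hopf_conformal \<alpha> a p g
  proof unfold_locales
    have "smooth_on (- {0}) (\<lambda>z. F (hopf_orbit \<alpha> z))" using F by (simp add: hopf_functions_def)
    then show "smooth_on (- {0}) p"
      unfolding p_def[abs_def]
      by (intro smooth_on_mult smooth_on_inner smooth_on_inverse smooth_on_const smooth_on_id)
        (auto simp: Fz open_Compl)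
    show "0 < p z" if "z \<noteq> 0" for z using Fz[OF that] that by (simp add: p_def)
    show "p (hopf_map \<alpha> z) = a\<^sup>2 * p z" for z by (simp add: p_def inner_hopf_map hopf_orbit_hopf_map)
    show "g z u v = (u \<bullet> v) / p z" if z: "z \<noteq> 0" for z u v
    proof -
      have "g z u v = kahler_form g z (- J u) v" by (simp add: kahler_form_def J_simps)
      also have "\<dots> = F (hopf_orbit \<alpha> z) * (2 * (u \<bullet> v) / (z \<bullet> z))"
        by (simp add: K[OF z] omega_h_def omega0_eq J_simps power2_norm_eq_inner)
      finally show ?thesis using Fz[OF z] z by (simp add: p_def field_simps)
    qed
  qed
  show ?thesis by (rule pointwise_constant_iff_admissible[OF assms(1,3)])
qed

end
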